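(* Let $\mathcal{C}$ be a subcategory of $\mathbf{Top}_{3\frac12}$ and let $F:\mathcal{C}\to \mathbf{Top}_{\mathrm{cpt},2}$ be a preweak compactification functor. Then there is a unique (up to natural isomorphism) contravariant functor $G:\mathcal{C}\to \mathbf{C^{*}com}_{1}$ satisfying (i) for each object $X$ of $\mathcal{C}$, $G(X)$ is a unital C$^*$-subalgebra of $\mathrm{C}_b(X)$; (ii) for each morphism $f:X\to Y$ in $\mathcal{C}$, $G(f)$ is the restriction to $G(Y)$ of the $*$-homomorphism $\mathrm{C}_b(Y)\to \mathrm{C}_b(X)$, $g\mapsto g\circ f$; and such that $F$ is naturally isomorphic to the induced functor $\widetilde{G}=\mathrm{\Phi}\circ G$ of $G$. Moreover, $F$ is a weak compactification functor if and only if for each $X$ in $\mathcal{C}$, $G(X)$ separates the points of $X$. If each object of $\mathcal{C}$ is locally compact, then $F$ is a compactification functor if and only if for each $X$ in $\mathcal{C}$, $G(X)$ separates points and closed sets.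
   Context: $\mathbf{Top}_{3\frac12}$ is the category of Tychonoff spaces with continuous maps, $\mathbf{Top}_{\mathrm{cpt},2}$ the category of compact Hausdorff spaces with continuous maps, and $\mathbf{C^{*}com}_{1}$ the category of commutative unital C$^*$-algebras with unital $*$-homomorphisms. $\mathrm{C}_b(X)$ is the C$^*$-algebra of bounded continuous complex-valued functions on $X$. A functor $F:\mathcal{C}\to \mathbf{Top}_{\mathrm{cpt},2}$ is a preweak compactification functor if there is a correspondence $\tau$ assigning to each $X$ in $\mathcal{C}$ a continuous map $\tau_X:X\to F(X)$ with dense range such that $F(f)\circ\tau_X=\tau_Y\circ f$ for each morphism $f:X\to Y$ in $\mathcal{C}$. A preweak compactification functor is called a weak compactification functor (respectively, compactification functor) if each $\tau_X$ is injective (respectively, a homeomorphic embedding). $\mathrm{\Phi}:\mathbf{C^{*}com}_{1}\to \mathbf{Top}_{\mathrm{cpt},2}$ is the contravariant functor sending $A$ to its character space $\mathrm{\Phi}_A$ (the nonzero homomorphisms $A\to\mathbb{C}$ with the Gelfand topology) and $\varphi:A\to B$ to the map $\mathrm{\Phi}_B\to\mathrm{\Phi}_A$, $\xi\mapsto \xi\circ\varphi$. For a functor $G$ satisfying (i) and (ii), the induced functor $\widetilde{G}=\mathrm{\Phi}\circ G$, together with the maps $X\to\widetilde{G}(X)$ sending $x$ to evaluation at $x$ on $G(X)$, is a preweak compactification functor. A family $\mathfrak{F}\subseteq \mathrm{C}_b(X)$ separates points and closed sets if for every closed $E\subseteq X$ and $x\in X\setminus E$ there is $f\in\mathfrak{F}$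 with $f(x)\notin\overline{f(E)}$.
   Formalization: The "moreover" part is stated for those G whose natural isomorphism F ≅ Φ∘G carries each τ_X to the evaluation map; for a bare natural isomorphism it fails (X = ℕ, F(X) = βℕ, G(X) = {f : f(0) = f(1)}). Such a G is shown to exist, and uniqueness is stated for bare natural isomorphisms. *)

theory Defs
  imports "HOL-Analysis.Analysis" "HOL-Algebra.Module"
begin

text \<open>Morphisms need not determine their domain and codomain, so identities, composition and
  the morphism part of a functor carry the objects as arguments.\<close>

record ('o, 'm) category =
  Obj :: "'o set"
  Hom :: "'o \<Rightarrow> 'o \<Rightarrow> 'm set"
  Ident :: "'o \<Rightarrow> 'm"
  Comp :: "'o \<Rightarrow> 'o \<Rightarrow> 'o \<Rightarrow> 'm \<Rightarrow> 'm \<Rightarrow> 'm"  \<comment> \<open>\<open>Comp X Y Z g f\<close> is \<open>g\<close> after \<open>f\<close>, for \<open>f: X \<rightarrow> Y\<close>, \<open>g: Y \<rightarrow> Z\<close>\<close>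

record ('o, 'm, 'p, 'n) fctr =
  Fobj :: "'o \<Rightarrow> 'p"
  Fmor :: "'o \<Rightarrow> 'o \<Rightarrow> 'm \<Rightarrow> 'n"

definition subcategory :: "('o, 'm) category \<Rightarrow> ('o, 'm) category \<Rightarrow> bool" where
  "subcategory C D \<longleftrightarrow>
     Obj C \<subseteq> Obj D \<and>
     (\<forall>X\<in>Obj C. \<forall>Y\<in>Obj C. Hom C X Y \<subseteq> Hom D X Y) \<and>
     (\<forall>X\<in>Obj C. Ident C X = Ident D X \<and> Ident C X \<in> Hom C X X) \<and>
     (\<forall>X\<in>Obj C. \<forall>Y\<in>Obj C. \<forall>Z\<in>Obj C. \<forall>f\<in>Hom C X Y. \<forall>g\<in>Hom C Y Z.
        Comp C X Y Z g f = Comp D X Y Z g f \<and> Comp C X Y Z g f \<in> Hom C X Z)"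

definition covariant_functor ::
    "('o, 'm) category \<Rightarrow> ('p, 'n) category \<Rightarrow> ('o, 'm, 'p, 'n) fctr \<Rightarrow> bool" where
  "covariant_functor C D F \<longleftrightarrow>
     (\<forall>X\<in>Obj C. Fobj F X \<in> Obj D) \<and>
     (\<forall>X\<in>Obj C. \<forall>Y\<in>Obj C. \<forall>f\<in>Hom C X Y. Fmor F X Y f \<in> Hom D (Fobj F X) (Fobj F Y)) \<and>
     (\<forall>X\<in>Obj C. Fmor F X X (Ident C X) = Ident D (Fobj F X)) \<and>
     (\<forall>X\<in>Obj C. \<forall>Y\<in>Obj C. \<forall>Z\<in>Obj C. \<forall>f\<in>Hom C X Y. \<forall>g\<in>Hom C Y Z.
        Fmor F X Z (Comp C X Y Z g f) =
        Comp D (Fobj F X) (Fobj F Y) (Fobj F Z) (Fmor F Y Z g) (Fmor F X Y f))"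

definition contravariant_functor ::
    "('o, 'm) category \<Rightarrow> ('p, 'n) category \<Rightarrow> ('o, 'm, 'p, 'n) fctr \<Rightarrow> bool" where
  "contravariant_functor C D G \<longleftrightarrow>
     (\<forall>X\<in>Obj C. Fobj G X \<in> Obj D) \<and>
     (\<forall>X\<in>Obj C. \<forall>Y\<in>Obj C. \<forall>f\<in>Hom C X Y. Fmor G X Y f \<in> Hom D (Fobj G Y) (Fobj G X)) \<and>
     (\<forall>X\<in>Obj C. Fmor G X X (Ident C X) = Ident D (Fobj G X)) \<and>
     (\<forall>X\<in>Obj C. \<forall>Y\<in>Obj C. \<forall>Z\<in>Obj C. \<forall>f\<in>Hom C X Y. \<forall>g\<in>Hom C Y Z.
        Fmor G X Z (Comp C X Y Z g f) =
        Comp D (Fobj G Z) (Fobj G Y) (Fobj G X) (Fmor G X Y f) (Fmor G Y Z g))"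

definition comp_contravariant ::
    "('p, 'n, 'q, 'r) fctr \<Rightarrow> ('o, 'm, 'p, 'n) fctr \<Rightarrow> ('o, 'm, 'q, 'r) fctr" where
  "comp_contravariant H G =
     \<lparr>Fobj = (\<lambda>X. Fobj H (Fobj G X)),
      Fmor = (\<lambda>X Y f. Fmor H (Fobj G Y) (Fobj G X) (Fmor G X Y f))\<rparr>"

definition isomorphism :: "('o, 'm) category \<Rightarrow> 'o \<Rightarrow> 'o \<Rightarrow> 'm \<Rightarrow> bool" where
  "isomorphism D A B h \<longleftrightarrow>
     h \<in> Hom D A B \<and>
     (\<exists>k\<in>Hom D B A. Comp D A B A k h = Ident D A \<and> Comp D B A B h k = Ident D B)"

definition contra_naturally_isomorphic ::
    "('o, 'm) category \<Rightarrow> ('p, 'n) category \<Rightarrow> ('o, 'm, 'p, 'n) fctr \<Rightarrow> ('o, 'm, 'p, 'n) fctr \<Rightarrow> bool"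
  where
  "contra_naturally_isomorphic C D G H \<longleftrightarrow>
     (\<exists>\<eta>. (\<forall>X\<in>Obj C. isomorphism D (Fobj G X) (Fobj H X) (\<eta> X)) \<and>
          (\<forall>X\<in>Obj C. \<forall>Y\<in>Obj C. \<forall>f\<in>Hom C X Y.
             Comp D (Fobj G Y) (Fobj G X) (Fobj H X) (\<eta> X) (Fmor G X Y f) =
             Comp D (Fobj G Y) (Fobj H Y) (Fobj H X) (Fmor H X Y f) (\<eta> Y)))"

text \<open>Maps out of \<open>X\<close> are extensional (\<open>undefined\<close> off \<open>topspace X\<close>), so that HOL equality
  of morphisms is equality on \<open>topspace X\<close>.\<close>

definition top_category :: "('a topology \<Rightarrow> bool) \<Rightarrow> ('a topology, 'a \<Rightarrow> 'a) category" where
  "top_category P =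
     \<lparr>Obj = {X. P X},
      Hom = (\<lambda>X Y. {f. continuous_map X Y f \<and> f \<in> extensional (topspace X)}),
      Ident = (\<lambda>X. \<lambda>x\<in>topspace X. x),
      Comp = (\<lambda>X Y Z g f. compose (topspace X) g f)\<rparr>"

definition Tych :: "('a topology, 'a \<Rightarrow> 'a) category" where
  "Tych = top_category (\<lambda>X. completely_regular_space X \<and> Hausdorff_space X)"

definition CompHaus :: "('a topology, 'a \<Rightarrow> 'a) category" where
  "CompHaus = top_category (\<lambda>X. compact_space X \<and> Hausdorff_space X)"

text \<open>The two functors may take values in spaces over different HOL types.\<close>

definition top_natural_isomorphism ::
    "('o, 'm) category \<Rightarrow> ('o, 'm, 'b topology, 'b \<Rightarrow> 'b) fctr \<Rightarrow>
     ('o, 'm, 'c topology, 'c \<Rightarrow> 'c) fctr \<Rightarrow> ('o \<Rightarrow> 'b \<Rightarrow> 'c) \<Rightarrow> bool" where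
  "top_natural_isomorphism C F H \<eta> \<longleftrightarrow>
     (\<forall>X\<in>Obj C. homeomorphic_map (Fobj F X) (Fobj H X) (\<eta> X)) \<and>
     (\<forall>X\<in>Obj C. \<forall>Y\<in>Obj C. \<forall>f\<in>Hom C X Y. \<forall>p\<in>topspace (Fobj F X).
        \<eta> Y (Fmor F X Y f p) = Fmor H X Y f (\<eta> X p))"

definition preweak_compactification_functor ::
    "('a topology, 'a \<Rightarrow> 'a) category \<Rightarrow> ('a topology, 'a \<Rightarrow> 'a, 'b topology, 'b \<Rightarrow> 'b) fctr \<Rightarrow>
     ('a topology \<Rightarrow> 'a \<Rightarrow> 'b) \<Rightarrow> bool" where
  "preweak_compactification_functor C F \<tau> \<longleftrightarrow>
     covariant_functor C CompHaus F \<and>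
     (\<forall>X\<in>Obj C. continuous_map X (Fobj F X) (\<tau> X) \<and>
        Fobj F X closure_of (\<tau> X ` topspace X) = topspace (Fobj F X)) \<and>
     (\<forall>X\<in>Obj C. \<forall>Y\<in>Obj C. \<forall>f\<in>Hom C X Y. \<forall>x\<in>topspace X.
        Fmor F X Y f (\<tau> X x) = \<tau> Y (f x))"

definition weak_compactification_functor ::
    "('a topology, 'a \<Rightarrow> 'a) category \<Rightarrow> ('a topology, 'a \<Rightarrow> 'a, 'b topology, 'b \<Rightarrow> 'b) fctr \<Rightarrow>
     ('a topology \<Rightarrow> 'a \<Rightarrow> 'b) \<Rightarrow> bool" where
  "weak_compactification_functor C F \<tau> \<longleftrightarrow>
     preweak_compactification_functor C F \<tau> \<and> (\<forall>X\<in>Obj C. inj_on (\<tau> X) (topspace X))"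

definition compactification_functor ::
    "('a topology, 'a \<Rightarrow> 'a) category \<Rightarrow> ('a topology, 'a \<Rightarrow> 'a, 'b topology, 'b \<Rightarrow> 'b) fctr \<Rightarrow>
     ('a topology \<Rightarrow> 'a \<Rightarrow> 'b) \<Rightarrow> bool" where
  "compactification_functor C F \<tau> \<longleftrightarrow>
     preweak_compactification_functor C F \<tau> \<and> (\<forall>X\<in>Obj C. embedding_map X (Fobj F X) (\<tau> X))"

record 'e cstar_algebra = "(complex, 'e) module" +
  star :: "'e \<Rightarrow> 'e"
  nrm :: "'e \<Rightarrow> real"

definition complex_ring :: "complex ring" where
  "complex_ring = \<lparr>carrier = UNIV, mult = (*), one = 1, zero = 0, add = (+)\<rparr>"

text \<open>The guard is there because the locale \<open>Metric_space\<close> asks for nonnegativity and symmetry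
  on the whole type.\<close>

definition cstar_dist :: "'e cstar_algebra \<Rightarrow> 'e \<Rightarrow> 'e \<Rightarrow> real" where
  "cstar_dist A x y = (if x \<in> carrier A \<and> y \<in> carrier A then nrm A (x \<ominus>\<^bsub>A\<^esub> y) else 0)"

text \<open>The zero algebra is admitted: it is \<open>C\<^sub>b\<close> of the empty space.\<close>

definition comm_unital_cstar_algebra :: "'e cstar_algebra \<Rightarrow> bool" where
  "comm_unital_cstar_algebra A \<longleftrightarrow>
     Module.algebra complex_ring A \<and>
     (\<forall>x\<in>carrier A. 0 \<le> nrm A x) \<and>
     (\<forall>x\<in>carrier A. nrm A x = 0 \<longleftrightarrow> x = \<zero>\<^bsub>A\<^esub>) \<and>
     (\<forall>x\<in>carrier A. \<forall>y\<in>carrier A. nrm A (x \<oplus>\<^bsub>A\<^esub> y) \<le> nrm A x + nrm A y) \<and>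
     (\<forall>c. \<forall>x\<in>carrier A. nrm A (c \<odot>\<^bsub>A\<^esub> x) = cmod c * nrm A x) \<and>
     (\<forall>x\<in>carrier A. \<forall>y\<in>carrier A. nrm A (x \<otimes>\<^bsub>A\<^esub> y) \<le> nrm A x * nrm A y) \<and>
     Metric_space.mcomplete (carrier A) (cstar_dist A) \<and>
     (\<forall>x\<in>carrier A. star A x \<in> carrier A \<and> star A (star A x) = x) \<and>
     (\<forall>x\<in>carrier A. \<forall>y\<in>carrier A. star A (x \<oplus>\<^bsub>A\<^esub> y) = star A x \<oplus>\<^bsub>A\<^esub> star A y) \<and>
     (\<forall>c. \<forall>x\<in>carrier A. star A (c \<odot>\<^bsub>A\<^esub> x) = cnj c \<odot>\<^bsub>A\<^esub> star A x) \<and>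
     (\<forall>x\<in>carrier A. \<forall>y\<in>carrier A. star A (x \<otimes>\<^bsub>A\<^esub> y) = star A y \<otimes>\<^bsub>A\<^esub> star A x) \<and>
     (\<forall>x\<in>carrier A. nrm A (star A x \<otimes>\<^bsub>A\<^esub> x) = (nrm A x)\<^sup>2)"

definition unital_star_hom :: "'e cstar_algebra \<Rightarrow> 'f cstar_algebra \<Rightarrow> ('e \<Rightarrow> 'f) set" where
  "unital_star_hom A B =
     {\<phi> \<in> ring_hom A B. \<phi> \<in> extensional (carrier A) \<and>
        (\<forall>c. \<forall>x\<in>carrier A. \<phi> (c \<odot>\<^bsub>A\<^esub> x) = c \<odot>\<^bsub>B\<^esub> \<phi> x) \<and>
        (\<forall>x\<in>carrier A. \<phi> (star A x) = star B (\<phi> x))}"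

definition CStarCom1 :: "('e cstar_algebra, 'e \<Rightarrow> 'e) category" where
  "CStarCom1 =
     \<lparr>Obj = {A. comm_unital_cstar_algebra A},
      Hom = unital_star_hom,
      Ident = (\<lambda>A. \<lambda>x\<in>carrier A. x),
      Comp = (\<lambda>A B D \<psi> \<phi>. compose (carrier A) \<psi> \<phi>)\<rparr>"

definition unital_cstar_subalgebra :: "'e cstar_algebra \<Rightarrow> 'e cstar_algebra \<Rightarrow> bool" where
  "unital_cstar_subalgebra B A \<longleftrightarrow>
     (\<exists>S. S \<subseteq> carrier A \<and> B = A\<lparr>carrier := S\<rparr> \<and>
        \<one>\<^bsub>A\<^esub> \<in> S \<and>
        (\<forall>x\<in>S. \<forall>y\<in>S. x \<oplus>\<^bsub>A\<^esub> y \<in> S \<and> x \<otimes>\<^bsub>A\<^esub> y \<in> S) \<and>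
        (\<forall>c. \<forall>x\<in>S. c \<odot>\<^bsub>A\<^esub> x \<in> S) \<and>
        (\<forall>x\<in>S. star A x \<in> S) \<and>
        closedin (Metric_space.mtopology (carrier A) (cstar_dist A)) S)"

text \<open>In \<open>Cb\<close> the element \<open>0\<close> is inserted so that the norm on \<open>C\<^sub>b\<close> of the empty space is \<open>0\<close>;
  it does not change the supremum when the space is nonempty.\<close>

definition Cb :: "'a topology \<Rightarrow> ('a \<Rightarrow> complex) cstar_algebra" where
  "Cb X =
     \<lparr>carrier = {g. continuous_map X euclidean g \<and> bounded (g ` topspace X) \<and>
                    g \<in> extensional (topspace X)},
      mult = (\<lambda>g h. \<lambda>x\<in>topspace X. g x * h x),
      one = (\<lambda>x\<in>topspace X. 1),
      zero = (\<lambda>x\<in>topspace X. 0),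
      add = (\<lambda>g h. \<lambda>x\<in>topspace X. g x + h x),
      smult = (\<lambda>c g. \<lambda>x\<in>topspace X. c * g x),
      star = (\<lambda>g. \<lambda>x\<in>topspace X. cnj (g x)),
      nrm = (\<lambda>g. Sup (insert 0 ((\<lambda>x. cmod (g x)) ` topspace X)))\<rparr>"

definition characters :: "'e cstar_algebra \<Rightarrow> ('e \<Rightarrow> complex) set" where
  "characters A =
     {\<xi> \<in> extensional (carrier A).
        (\<forall>x\<in>carrier A. \<forall>y\<in>carrier A. \<xi> (x \<oplus>\<^bsub>A\<^esub> y) = \<xi> x + \<xi> y \<and> \<xi> (x \<otimes>\<^bsub>A\<^esub> y) = \<xi> x * \<xi> y) \<and>
        (\<forall>c. \<forall>x\<in>carrier A. \<xi> (c \<odot>\<^bsub>A\<^esub> x) = c * \<xi> x) \<and>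
        (\<exists>x\<in>carrier A. \<xi> x \<noteq> 0)}"

text \<open>The Gelfand topology is the topology of pointwise convergence on the algebra.\<close>

definition character_space :: "'e cstar_algebra \<Rightarrow> ('e \<Rightarrow> complex) topology" where
  "character_space A =
     subtopology (product_topology (\<lambda>_. euclidean) (carrier A)) (characters A)"

definition Phi ::
    "('e cstar_algebra, 'e \<Rightarrow> 'e, ('e \<Rightarrow> complex) topology, ('e \<Rightarrow> complex) \<Rightarrow> ('e \<Rightarrow> complex)) fctr"
  where
  "Phi =
     \<lparr>Fobj = character_space,
      Fmor = (\<lambda>A B \<phi>. \<lambda>\<xi>\<in>characters B. compose (carrier A) \<xi> \<phi>)\<rparr>"

type_synonym 'a function_algebra_fctr =
  "('a topology, 'a \<Rightarrow> 'a, ('a \<Rightarrow> complex) cstar_algebra, ('a \<Rightarrow> complex) \<Rightarrow> ('a \<Rightarrow> complex)) fctr"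

definition function_algebra_functor ::
    "('a topology, 'a \<Rightarrow> 'a) category \<Rightarrow> 'a function_algebra_fctr \<Rightarrow> bool" where
  "function_algebra_functor C G \<longleftrightarrow>
     contravariant_functor C CStarCom1 G \<and>
     (\<forall>X\<in>Obj C. unital_cstar_subalgebra (Fobj G X) (Cb X)) \<and>
     (\<forall>X\<in>Obj C. \<forall>Y\<in>Obj C. \<forall>f\<in>Hom C X Y.
        Fmor G X Y f = (\<lambda>g\<in>carrier (Fobj G Y). compose (topspace X) g f))"

definition induced_functor ::
    "'a function_algebra_fctr \<Rightarrow>
     ('a topology, 'a \<Rightarrow> 'a, (('a \<Rightarrow> complex) \<Rightarrow> complex) topology,
      (('a \<Rightarrow> complex) \<Rightarrow> complex) \<Rightarrow> (('a \<Rightarrow> complex) \<Rightarrow> complex)) fctr" where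
  "induced_functor G = comp_contravariant Phi G"

definition evaluation :: "'a function_algebra_fctr \<Rightarrow> 'a topology \<Rightarrow> 'a \<Rightarrow> ('a \<Rightarrow> complex) \<Rightarrow> complex"
  where "evaluation G X x = (\<lambda>g\<in>carrier (Fobj G X). g x)"

definition represents ::
    "('a topology, 'a \<Rightarrow> 'a) category \<Rightarrow> 'a function_algebra_fctr \<Rightarrow>
     ('a topology, 'a \<Rightarrow> 'a, 'b topology, 'b \<Rightarrow> 'b) fctr \<Rightarrow> bool" where
  "represents C G F \<longleftrightarrow>
     function_algebra_functor C G \<and> (\<exists>\<eta>. top_natural_isomorphism C F (induced_functor G) \<eta>)"

text \<open>Same, but the natural isomorphism also carries the maps \<open>\<tau>\<^sub>X\<close> to the evaluation maps.
  This matters when properties of \<open>\<tau>\<close> are read off from \<open>G\<close>: a natural isomorphism of the bare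
  functors determines the algebras \<open>G(X)\<close> only up to isomorphism, not as subalgebras of \<open>C\<^sub>b(X)\<close>,
  and says nothing about separation of points.\<close>

definition represents_along ::
    "('a topology, 'a \<Rightarrow> 'a) category \<Rightarrow> 'a function_algebra_fctr \<Rightarrow>
     ('a topology, 'a \<Rightarrow> 'a, 'b topology, 'b \<Rightarrow> 'b) fctr \<Rightarrow> ('a topology \<Rightarrow> 'a \<Rightarrow> 'b) \<Rightarrow> bool" where
  "represents_along C G F \<tau> \<longleftrightarrow>
     function_algebra_functor C G \<and>
     (\<exists>\<eta>. top_natural_isomorphism C F (induced_functor G) \<eta> \<and>
          (\<forall>X\<in>Obj C. \<forall>x\<in>topspace X. \<eta> X (\<tau> X x) = evaluation G X x))"

definition separates_points :: "'a topology \<Rightarrow> ('a \<Rightarrow> complex) set \<Rightarrow> bool" where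
  "separates_points X \<FF> \<longleftrightarrow>
     (\<forall>x\<in>topspace X. \<forall>y\<in>topspace X. x \<noteq> y \<longrightarrow> (\<exists>f\<in>\<FF>. f x \<noteq> f y))"

definition separates_points_closed_sets :: "'a topology \<Rightarrow> ('a \<Rightarrow> complex) set \<Rightarrow> bool" where
  "separates_points_closed_sets X \<FF> \<longleftrightarrow>
     (\<forall>E. closedin X E \<longrightarrow> (\<forall>x\<in>topspace X - E. \<exists>f\<in>\<FF>. f x \<notin> closure (f ` E)))"

end

theory Submission
  imports Defs
begin

text \<open>The algebra \<open>G(X)\<close> consists of the functions \<open>k \<circ> \<tau>\<^sub>X\<close> with \<open>k\<close> continuous on \<open>F(X)\<close>. It is a
  closed subalgebra of \<open>C\<^sub>b(X)\<close> because, by density of \<open>\<tau>\<^sub>X\<close>, the map \<open>k \<mapsto> k \<circ> \<tau>\<^sub>X\<close> is isometric;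
  the map sending \<open>p \<in> F(X)\<close> to the character \<open>k \<circ> \<tau>\<^sub>X \<mapsto> k(p)\<close> is injective by Urysohn's lemma,
  and it is onto because its image is compact and contains the evaluations at points of \<open>X\<close>,
  which are dense in every character space \<open>\<Phi>\<^bsub>A\<^esub>\<close> with \<open>A \<subseteq> C\<^sub>b(X)\<close>. For uniqueness,
  Stone-Weierstrass identifies \<open>G(X)\<close> with the continuous functions on its character space, hence
  with those on \<open>F(X)\<close>. The natural homeomorphism turns \<open>\<tau>\<^sub>X\<close> into the evaluation map of \<open>G(X)\<close>,
  from which the separation criteria are read off.\<close>

section \<open>Closed subalgebras of \<open>C\<^sub>b(X)\<close>\<close>

text \<open>Compactness of a character space is nowhere derived from the algebra: it is carried over
  from F(X) by a homeomorphism. The Gelfand theory therefore works with an arbitrary uniformly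
  closed star-subalgebra \<open>S\<close> of bounded continuous functions, and compactness is a
  hypothesis of the surjectivity step alone. Characters come without continuity or unitality.
  Unitality follows by cancellation, and multiplicativity bounds \<open>\<xi> f\<close> by any bound
  of f on X; compatibility with conjugation is a consequence of this bound. Density of the
  evaluations is obtained without ideals: finitely many coordinate conditions around a character are
  merged into one nonnegative function in \<open>S\<close>, and a neighbourhood missing all
  evaluations would keep this function away from zero. The same function gives one half of the
  embedding criterion. For uniqueness, the two algebras are compared through the values of their
  characters, since nothing relates their elements as functions on X.\<close>

text \<open>The Stone-Weierstrass theorem of the library is stated for the class \<open>t2_space\<close>, whereas function
  types are so far instances only for countable domains and metric codomains. The weaker
  separation classes have to be instantiated first, since their arities would otherwise clash.\<close>

lemma open_vimage_apply: "open W \<Longrightarrow> open ((\<lambda>h :: 'a \<Rightarrow> 'b::topological_space. h i) -` W)"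
  by (intro open_vimage continuous_intros) auto

instance "fun" :: (type, t0_space) t0_space
proof
  fix f g :: "'a \<Rightarrow> 'b" assume "f \<noteq> g"
  then obtain i where "f i \<noteq> g i" by auto
  then obtain U where "open U" "\<not> (f i \<in> U \<longleftrightarrow> g i \<in> U)"
    using separation_t0[of "f i" "g i"] by blast
  then show "\<exists>U. open U \<and> \<not> (f \<in> U \<longleftrightarrow> g \<in> U)"
    by (intro exI[of _ "(\<lambda>h. h i) -` U"]) (auto simp: open_vimage_apply)
qed

instance "fun" :: (type, t1_space) t1_space
proof
  fix f g :: "'a \<Rightarrow> 'b" assume "f \<noteq> g"
  then obtain i where "f i \<noteq> g i" by auto
  then obtain U where "open U" "f i \<in> U" "g i \<notin> U"
    using separation_t1[of "f i" "g i"] by blast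
  then show "\<exists>U. open U \<and> f \<in> U \<and> g \<notin> U"
    by (intro exI[of _ "(\<lambda>h. h i) -` U"]) (auto simp: open_vimage_apply)
qed

instance "fun" :: (type, t2_space) t2_space
proof
  fix f g :: "'a \<Rightarrow> 'b" assume "f \<noteq> g"
  then obtain i where "f i \<noteq> g i" by auto
  then obtain U V where "open U" "open V" "f i \<in> U" "g i \<in> V" "U \<inter> V = {}"
    using separation_t2[of "f i" "g i"] by blast
  then show "\<exists>U V. open U \<and> open V \<and> f \<in> U \<and> g \<in> V \<and> U \<inter> V = {}"
    by (intro exI[of _ "(\<lambda>h. h i) -` U"] exI[of _ "(\<lambda>h. h i) -` V"])
       (auto simp: open_vimage_apply)
qed

section \<open>Bounded continuous functions and the supremum norm\<close>

lemma continuous_map_complex_mult: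
  fixes f g :: "'a \<Rightarrow> complex"
  shows "continuous_map X euclidean f \<Longrightarrow> continuous_map X euclidean g \<Longrightarrow>
    continuous_map X euclidean (\<lambda>x. f x * g x)"
  by (simp add: continuous_map_atin tendsto_mult)

lemma continuous_map_cnj:
  "continuous_map X euclidean f \<Longrightarrow> continuous_map X euclidean (\<lambda>x. cnj (f x))"
  by (simp add: continuous_map_atin tendsto_cnj)

lemma continuous_map_of_real:
  fixes f :: "'a \<Rightarrow> real"
  shows "continuous_map X euclidean f \<Longrightarrow>
    continuous_map X euclidean (\<lambda>x. complex_of_real (f x))"
  by (simp add: continuous_map_atin tendsto_of_real)

lemma continuous_map_restrict:
  "continuous_map X Y (restrict f (topspace X)) \<longleftrightarrow> continuous_map X Y f"
  by (auto elim!: continuous_map_eq)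

lemma Cb_sel:
  "mult (Cb X) = (\<lambda>g h. \<lambda>x\<in>topspace X. g x * h x)"
  "one (Cb X) = (\<lambda>x\<in>topspace X. 1)"
  "zero (Cb X) = (\<lambda>x\<in>topspace X. 0)"
  "add (Cb X) = (\<lambda>g h. \<lambda>x\<in>topspace X. g x + h x)"
  "smult (Cb X) = (\<lambda>c g. \<lambda>x\<in>topspace X. c * g x)"
  "star (Cb X) = (\<lambda>g. \<lambda>x\<in>topspace X. cnj (g x))"
  "nrm (Cb X) = (\<lambda>g. Sup (insert 0 ((\<lambda>x. cmod (g x)) ` topspace X)))"
  by (simp_all add: Cb_def)

lemma in_Cb_iff:
  "g \<in> carrier (Cb X) \<longleftrightarrow> continuous_map X euclidean g \<and> bounded (g ` topspace X) \<and>
    g \<in> extensional (topspace X)"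
  by (simp add: Cb_def)

lemma in_CbI:
  assumes "continuous_map X euclidean g" "\<And>x. x \<in> topspace X \<Longrightarrow> cmod (g x) \<le> B"
    "g \<in> extensional (topspace X)"
  shows "g \<in> carrier (Cb X)"
  using assms unfolding in_Cb_iff bounded_iff by blast

lemma Cb_boundE:
  assumes "g \<in> carrier (Cb X)"
  obtains B where "\<And>x. x \<in> topspace X \<Longrightarrow> cmod (g x) \<le> B"
  using assms unfolding in_Cb_iff bounded_iff by blast

lemma cmod_le_nrm_Cb:
  assumes "g \<in> carrier (Cb X)" "x \<in> topspace X"
  shows "cmod (g x) \<le> nrm (Cb X) g"
proof -
  obtain B where "\<And>x. x \<in> topspace X \<Longrightarrow> cmod (g x) \<le> B"
    using Cb_boundE[OF assms(1)] by blast
  \<comment> \<open>The bound is \<open>max 0 B\<close>: on an empty space \<open>B\<close> is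
    arbitrary and may be negative, while the set still contains 0.\<close>
  then have "bdd_above (insert 0 ((\<lambda>x. cmod (g x)) ` topspace X))"
    unfolding bdd_above_def by (intro exI[of _ "max 0 B"]) force
  then show ?thesis
    using assms(2) by (auto simp: Cb_sel intro!: cSup_upper)
qed

lemma nrm_Cb_le:
  assumes "0 \<le> B" "\<And>x. x \<in> topspace X \<Longrightarrow> cmod (g x) \<le> B"
  shows "nrm (Cb X) g \<le> B"
  unfolding Cb_sel using assms by (intro cSup_least) auto

lemma nrm_Cb_nonneg:
  assumes "g \<in> carrier (Cb X)"
  shows "0 \<le> nrm (Cb X) g"
proof -
  obtain B where "\<And>x. x \<in> topspace X \<Longrightarrow> cmod (g x) \<le> B"
    using Cb_boundE[OF assms] by blast
  then have "bdd_above (insert 0 ((\<lambda>x. cmod (g x)) ` topspace X))"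
    unfolding bdd_above_def by (intro exI[of _ "max 0 B"]) force
  then show ?thesis
    by (auto simp: Cb_sel intro!: cSup_upper)
qed

text \<open>Phrased with pointwise errors instead of the norm, so that it is literally the closure
  condition \<open>uniform_limit_in\<close> for the full algebra. It also supplies continuity of
  uniform limits on a compact space later.\<close>

lemma Cb_uniform_limit:
  assumes ext: "g \<in> extensional (topspace X)"
    and approx: "\<And>e. 0 < e \<Longrightarrow> \<exists>f\<in>carrier (Cb X). \<forall>x\<in>topspace X. cmod (f x - g x) < e"
  shows "g \<in> carrier (Cb X)"
proof -
  have "\<exists>f. \<forall>n. f n \<in> carrier (Cb X) \<and> (\<forall>x\<in>topspace X. cmod (f n x - g x) < inverse (Suc n))"
    using approx by (intro choice) (auto simp: Bex_def)
  then obtain f where f: "\<And>n::nat. f n \<in> carrier (Cb X)"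
    and fg: "\<And>n x. x \<in> topspace X \<Longrightarrow> cmod (f n x - g x) < inverse (Suc n)"
    by blast
  have "continuous_map X Met_TC.mtopology g"
  proof (rule Met_TC.continuous_map_uniform_limit[where F = sequentially and f = f])
    show "\<forall>\<^sub>F n in sequentially. \<forall>x\<in>topspace X. g x \<in> UNIV \<and> dist (f n x) (g x) < e"
      if e: "0 < e" for e
    proof -
      obtain N where N: "inverse (real (Suc N)) < e"
        using reals_Archimedean[OF e] by blast
      have "dist (f n x) (g x) < e" if "N \<le> n" "x \<in> topspace X" for n x
      proof -
        have "inverse (real (Suc n)) \<le> inverse (real (Suc N))"
          using that(1) by (simp add: field_simps)
        then show ?thesis
          using fg[OF that(2), of n] N unfolding dist_norm by linarith
      qed
      then show ?thesis
        by (auto simp: eventually_sequentially)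
    qed
  qed (use f in \<open>auto simp: in_Cb_iff\<close>)
  moreover obtain B where "\<And>x. x \<in> topspace X \<Longrightarrow> cmod (f 0 x) \<le> B"
    using Cb_boundE[OF f] by blast
  \<comment> \<open>The summand 1 is the error of the approximant with index 0,
    \<open>inverse (Suc 0)\<close>.\<close>
  then have "cmod (g x) \<le> B + 1" if "x \<in> topspace X" for x
    using fg[OF that, of 0] that norm_triangle_sub[of "g x" "f 0 x"]
    by (force simp: norm_minus_commute)
  ultimately show ?thesis
    using ext by (intro in_CbI) auto
qed

text \<open>Closedness in the metric topology is replaced by uniform approximation, which speaks of
  points only. The limit is merely required to be extensional, because a uniform limit of members of
  C_b(X) lies in C_b(X) anyway. \<open>unital_cstar_subalgebra_Cb_iff\<close> shows that nothing is
  changed by this.\<close>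

locale closed_function_algebra =
  fixes X :: "'a topology" and S :: "('a \<Rightarrow> complex) set"
  assumes subset_Cb: "S \<subseteq> carrier (Cb X)"
    and one_in: "(\<lambda>x\<in>topspace X. 1) \<in> S"
    and add_in: "\<And>f g. f \<in> S \<Longrightarrow> g \<in> S \<Longrightarrow> (\<lambda>x\<in>topspace X. f x + g x) \<in> S"
    and mult_in: "\<And>f g. f \<in> S \<Longrightarrow> g \<in> S \<Longrightarrow> (\<lambda>x\<in>topspace X. f x * g x) \<in> S"
    and smult_in: "\<And>c f. f \<in> S \<Longrightarrow> (\<lambda>x\<in>topspace X. c * f x) \<in> S"
    and star_in: "\<And>f. f \<in> S \<Longrightarrow> (\<lambda>x\<in>topspace X. cnj (f x)) \<in> S"
    and uniform_limit_in: "\<And>g. g \<in> extensional (topspace X) \<Longrightarrow>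
      (\<And>e. 0 < e \<Longrightarrow> \<exists>f\<in>S. \<forall>x\<in>topspace X. cmod (f x - g x) < e) \<Longrightarrow> g \<in> S"
begin

abbreviation alg :: "('a \<Rightarrow> complex) cstar_algebra" where
  "alg \<equiv> (Cb X)\<lparr>carrier := S\<rparr>"

lemma alg_sel [simp]:
  "mult alg = (\<lambda>g h. \<lambda>x\<in>topspace X. g x * h x)"
  "one alg = (\<lambda>x\<in>topspace X. 1)"
  "zero alg = (\<lambda>x\<in>topspace X. 0)"
  "add alg = (\<lambda>g h. \<lambda>x\<in>topspace X. g x + h x)"
  "smult alg = (\<lambda>c g. \<lambda>x\<in>topspace X. c * g x)"
  "star alg = (\<lambda>g. \<lambda>x\<in>topspace X. cnj (g x))"
  "nrm alg = nrm (Cb X)"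
  by (simp_all add: Cb_def)

lemma ext: "f \<in> S \<Longrightarrow> f \<in> extensional (topspace X)"
  using subset_Cb by (auto simp: in_Cb_iff)

lemma const_in: "(\<lambda>x\<in>topspace X. c) \<in> S"
proof -
  have "(\<lambda>x\<in>topspace X. c * (\<lambda>x\<in>topspace X. 1) x) = (\<lambda>x\<in>topspace X. c)"
    by auto
  then show ?thesis
    using smult_in[OF one_in, of c] by simp
qed

lemma uminus_in: "f \<in> S \<Longrightarrow> (\<lambda>x\<in>topspace X. - f x) \<in> S"
  using smult_in[of f "-1"] by simp

lemma diff_in:
  assumes "f \<in> S" "g \<in> S"
  shows "(\<lambda>x\<in>topspace X. f x - g x) \<in> S"
proof -
  have "(\<lambda>x\<in>topspace X. f x + (\<lambda>x\<in>topspace X. - g x) x) = (\<lambda>x\<in>topspace X. f x - g x)"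
    by auto
  then show ?thesis
    using add_in[OF assms(1) uminus_in[OF assms(2)]] by simp
qed

lemma restrict_eq_self:
  assumes "f \<in> S" shows "restrict f (topspace X) = f"
  using ext[OF assms] by (simp add: extensional_restrict)

lemma cring_alg: "cring alg"
proof (rule cringI)
  show "abelian_group alg"
  proof (rule abelian_groupI)
    fix f assume "f \<in> carrier alg"
    then show "\<exists>g\<in>carrier alg. g \<oplus>\<^bsub>alg\<^esub> f = \<zero>\<^bsub>alg\<^esub>"
      by (intro bexI[of _ "\<lambda>x\<in>topspace X. - f x"]) (auto simp: uminus_in)
  qed (use add_in const_in in \<open>auto simp: restrict_eq_self cong: restrict_cong\<close>)
  show "comm_monoid alg"
    by (rule comm_monoidI)
      (use mult_in one_in in \<open>auto simp: restrict_eq_self mult_ac cong: restrict_cong\<close>)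
qed (auto simp: ring_distribs)

lemma algebra_alg: "Module.algebra complex_ring alg"
proof (rule algebraI)
  have "\<exists>y. y + x = 0" for x :: complex
    by (rule exI[of _ "- x"]) simp
  then show "cring complex_ring"
    by (intro cringI abelian_groupI comm_monoidI)
      (auto simp: complex_ring_def algebra_simps)
qed (use cring_alg smult_in in
    \<open>auto simp: complex_ring_def restrict_eq_self ring_distribs mult_ac cong: restrict_cong\<close>)

text \<open>Subtraction in a ring record is defined through a description of the additive inverse.
  The explicit formula is what makes \<open>cstar_dist\<close> computable.\<close>

lemma a_minus_alg:
  assumes "f \<in> S" "g \<in> S"
  shows "f \<ominus>\<^bsub>alg\<^esub> g = (\<lambda>x\<in>topspace X. f x - g x)"
proof -
  interpret cring alg by (rule cring_alg)
  have "\<ominus>\<^bsub>alg\<^esub> g = (\<lambda>x\<in>topspace X. - g x)"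
    using assms uminus_in by (intro minus_equality) auto
  then show ?thesis
    by (auto simp: minus_eq)
qed

lemma cstar_dist_less:
  assumes "f \<in> S" "g \<in> S" "cstar_dist alg f g < e" "x \<in> topspace X"
  shows "cmod (f x - g x) < e"
  using cmod_le_nrm_Cb[of "\<lambda>x\<in>topspace X. f x - g x" X x] diff_in[of f g] subset_Cb assms
  by (auto simp: cstar_dist_def a_minus_alg)

text \<open>Membership in \<open>S\<close> is not assumed: outside the carrier the guarded distance
  is 0, which \<open>0 \<le> e\<close> covers.\<close>

lemma cstar_dist_le:
  assumes "0 \<le> e" "\<And>x. x \<in> topspace X \<Longrightarrow> cmod (f x - g x) \<le> e"
  shows "cstar_dist alg f g \<le> e"
  using assms by (auto simp: cstar_dist_def a_minus_alg intro!: nrm_Cb_le)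

lemma nrm_eq_0_iff:
  assumes "f \<in> S"
  shows "nrm (Cb X) f = 0 \<longleftrightarrow> f = (\<lambda>x\<in>topspace X. 0)"
proof
  assume *: "nrm (Cb X) f = 0"
  show "f = (\<lambda>x\<in>topspace X. 0)"
  proof (rule extensionalityI[OF ext[OF assms]])
    fix x assume x: "x \<in> topspace X"
    then show "f x = (\<lambda>x\<in>topspace X. 0) x"
      using cmod_le_nrm_Cb[of f X x] assms subset_Cb * by auto
  qed auto
next
  assume "f = (\<lambda>x\<in>topspace X. 0)"
  then have "nrm (Cb X) f \<le> 0"
    by (intro nrm_Cb_le) auto
  then show "nrm (Cb X) f = 0"
    using nrm_Cb_nonneg[of f X] assms subset_Cb by auto
qed

lemma nrm_add_le:
  assumes "f \<in> S" "g \<in> S"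
  shows "nrm (Cb X) (\<lambda>x\<in>topspace X. f x + g x) \<le> nrm (Cb X) f + nrm (Cb X) g"
proof (rule nrm_Cb_le)
  have fg: "f \<in> carrier (Cb X)" "g \<in> carrier (Cb X)"
    using assms subset_Cb by auto
  then show "0 \<le> nrm (Cb X) f + nrm (Cb X) g"
    by (simp add: nrm_Cb_nonneg)
  fix x assume "x \<in> topspace X"
  then show "cmod ((\<lambda>x\<in>topspace X. f x + g x) x) \<le> nrm (Cb X) f + nrm (Cb X) g"
    using fg[THEN cmod_le_nrm_Cb, of x] norm_triangle_ineq[of "f x" "g x"] by simp
qed

lemma Metric_space_alg: "Metric_space S (cstar_dist alg)"
proof
  fix f g
  show "0 \<le> cstar_dist alg f g"
    using diff_in subset_Cb by (auto simp: cstar_dist_def a_minus_alg intro!: nrm_Cb_nonneg)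
  have "cstar_dist alg f g \<le> cstar_dist alg g f" for f g
    using diff_in[of f g] diff_in[of g f] subset_Cb
      cmod_le_nrm_Cb[of "\<lambda>x\<in>topspace X. g x - f x" X] nrm_Cb_nonneg[of "\<lambda>x\<in>topspace X. g x - f x" X]
    by (auto simp: cstar_dist_def a_minus_alg norm_minus_commute intro!: nrm_Cb_le)
  then show "cstar_dist alg f g = cstar_dist alg g f"
    by (simp add: order_antisym)
next
  fix f g assume fg: "f \<in> S" "g \<in> S"
  have "(\<lambda>x\<in>topspace X. f x - g x) = (\<lambda>x\<in>topspace X. 0) \<longleftrightarrow> f = g"
  proof
    assume *: "(\<lambda>x\<in>topspace X. f x - g x) = (\<lambda>x\<in>topspace X. 0)"
    have "f x = g x" if "x \<in> topspace X" for x
      using fun_cong[OF *, of x] that by simp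
    then show "f = g"
      using fg ext extensionalityI by blast
  qed auto
  then show "cstar_dist alg f g = 0 \<longleftrightarrow> f = g"
    using fg diff_in nrm_eq_0_iff by (simp add: cstar_dist_def a_minus_alg)
next
  fix f g h assume fgh: "f \<in> S" "g \<in> S" "h \<in> S"
  have "(\<lambda>x\<in>topspace X. f x - h x) =
    (\<lambda>x\<in>topspace X. (\<lambda>x\<in>topspace X. f x - g x) x + (\<lambda>x\<in>topspace X. g x - h x) x)"
    by auto
  then show "cstar_dist alg f h \<le> cstar_dist alg f g + cstar_dist alg g h"
    using fgh nrm_add_le[of "\<lambda>x\<in>topspace X. f x - g x" "\<lambda>x\<in>topspace X. g x - h x"] diff_in
    by (simp add: cstar_dist_def a_minus_alg)
qed

text \<open>A Cauchy sequence for the supremum distance is uniformly Cauchy on X, so completeness of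
  the complex numbers gives a uniform limit and \<open>uniform_limit_in\<close> keeps it in
  \<open>S\<close>.\<close>

lemma mcomplete_alg: "Metric_space.mcomplete S (cstar_dist alg)"
proof -
  interpret Metric_space S "cstar_dist alg" by (rule Metric_space_alg)
  have "\<exists>l. limitin mtopology s l sequentially" if s: "MCauchy s" for s
  proof -
    have sS: "s n \<in> S" for n
      using s by (auto simp: MCauchy_def)
    have "\<exists>N. \<forall>m n x. N \<le> m \<and> N \<le> n \<and> x \<in> topspace X \<longrightarrow> dist (s m x) (s n x) < e" if "0 < e" for e
    proof -
      obtain N where "\<And>m n. N \<le> m \<Longrightarrow> N \<le> n \<Longrightarrow> cstar_dist alg (s m) (s n) < e"
        using s \<open>0 < e\<close> unfolding MCauchy_def by blast
      then show ?thesis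
        using cstar_dist_less[OF sS sS] unfolding dist_norm by blast
    qed
    then obtain l0 where l0:
      "\<And>e. 0 < e \<Longrightarrow> \<exists>N. \<forall>n x. N \<le> n \<and> x \<in> topspace X \<longrightarrow> dist (s n x) (l0 x) < e"
      using uniformly_convergent_eq_cauchy[of "\<lambda>x. x \<in> topspace X" s] by blast
    \<comment> \<open>The limit \<open>l0\<close> is arbitrary off X, whereas members of
      \<open>S\<close> are extensional.\<close>
    define l where "l = restrict l0 (topspace X)"
    have conv: "\<exists>N. \<forall>n\<ge>N. \<forall>x\<in>topspace X. cmod (s n x - l x) < e" if "0 < e" for e
      using l0[OF that] by (auto simp: l_def dist_norm)
    have lS: "l \<in> S"
    proof (rule uniform_limit_in)
      show "l \<in> extensional (topspace X)"
        by (simp add: l_def)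
      show "\<exists>f\<in>S. \<forall>x\<in>topspace X. cmod (f x - l x) < e" if "0 < e" for e
        using conv[OF that] sS by blast
    qed
    have "\<exists>N. \<forall>n\<ge>N. s n \<in> S \<and> cstar_dist alg (s n) l < e" if "0 < e" for e
    proof -
      obtain N where N: "\<And>n x. N \<le> n \<Longrightarrow> x \<in> topspace X \<Longrightarrow> cmod (s n x - l x) < e / 2"
        using conv[of "e / 2"] \<open>0 < e\<close> by auto
      \<comment> \<open>Passing to the supremum weakens a strict inequality; \<open>e / 2\<close>
        makes room for that.\<close>
      have "cstar_dist alg (s n) l \<le> e / 2" if "N \<le> n" for n
        using N[OF that] \<open>0 < e\<close> by (intro cstar_dist_le) (auto simp: less_imp_le)
      then show ?thesis
        using \<open>0 < e\<close> sS by (intro exI[of _ N]) force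
    qed
    then show ?thesis
      using lS by (auto simp: limit_metric_sequentially)
  qed
  then show ?thesis
    unfolding mcomplete_def by blast
qed

lemma comm_unital_cstar_algebra_alg: "comm_unital_cstar_algebra alg"
proof -
  have Cb: "f \<in> carrier (Cb X)" if "f \<in> S" for f
    using that subset_Cb by auto
  have smult: "nrm (Cb X) (\<lambda>x\<in>topspace X. c * f x) = cmod c * nrm (Cb X) f" if f: "f \<in> S" for c f
  proof (rule antisym)
    show "nrm (Cb X) (\<lambda>x\<in>topspace X. c * f x) \<le> cmod c * nrm (Cb X) f"
      using cmod_le_nrm_Cb[OF Cb[OF f]] nrm_Cb_nonneg[OF Cb[OF f]]
      by (intro nrm_Cb_le) (auto simp: norm_mult mult_left_mono)
    show "cmod c * nrm (Cb X) f \<le> nrm (Cb X) (\<lambda>x\<in>topspace X. c * f x)"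
    proof (cases "c = 0")
      case True
      then show ?thesis using nrm_Cb_nonneg[OF Cb[OF smult_in[OF f, of c]]] by simp
    next
      case False
      \<comment> \<open>For the reverse estimate, each value of f is bounded by dividing the bound
        on c f by the modulus of c.\<close>
      have "nrm (Cb X) f \<le> nrm (Cb X) (\<lambda>x\<in>topspace X. c * f x) / cmod c"
        using cmod_le_nrm_Cb[OF Cb[OF smult_in[OF f, of c]]]
          nrm_Cb_nonneg[OF Cb[OF smult_in[OF f, of c]]] False
        by (intro nrm_Cb_le) (auto simp: norm_mult field_simps)
      then show ?thesis
        using False by (simp add: field_simps)
    qed
  qed
  have mult: "nrm (Cb X) (\<lambda>x\<in>topspace X. f x * g x) \<le> nrm (Cb X) f * nrm (Cb X) g"
    if f: "f \<in> S" and g: "g \<in> S" for f g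
    using cmod_le_nrm_Cb[OF Cb[OF f]] nrm_Cb_nonneg[OF Cb[OF f]]
      cmod_le_nrm_Cb[OF Cb[OF g]] nrm_Cb_nonneg[OF Cb[OF g]]
    by (intro nrm_Cb_le) (auto simp: norm_mult mult_mono)
  have cstar: "nrm (Cb X) (\<lambda>x\<in>topspace X. (\<lambda>x\<in>topspace X. cnj (f x)) x * f x) = (nrm (Cb X) f)\<^sup>2"
    (is "nrm _ ?h = _") if f: "f \<in> S" for f
  proof (rule antisym)
    have h: "?h \<in> S"
      using mult_in[OF star_in[OF f] f] by simp
    show "nrm (Cb X) ?h \<le> (nrm (Cb X) f)\<^sup>2"
      using cmod_le_nrm_Cb[OF Cb[OF f]] nrm_Cb_nonneg[OF Cb[OF f]]
      by (intro nrm_Cb_le) (auto simp: norm_mult power2_eq_square mult_mono)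
    \<comment> \<open>The modulus of \<open>?h\<close> at a point is the square of that of f, so the
      nontrivial half of the C*-identity is a pointwise square-root bound.\<close>
    have "nrm (Cb X) f \<le> sqrt (nrm (Cb X) ?h)"
      using cmod_le_nrm_Cb[OF Cb[OF h]] nrm_Cb_nonneg[OF Cb[OF h]]
      by (intro nrm_Cb_le) (auto simp: norm_mult power2_eq_square intro!: real_le_rsqrt)
    then have "(nrm (Cb X) f)\<^sup>2 \<le> (sqrt (nrm (Cb X) ?h))\<^sup>2"
      using nrm_Cb_nonneg[OF Cb[OF f]] by (intro power_mono)
    then show "(nrm (Cb X) f)\<^sup>2 \<le> nrm (Cb X) ?h"
      using nrm_Cb_nonneg[OF Cb[OF h]] by simp
  qed
  show ?thesis
    unfolding comm_unital_cstar_algebra_def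
    using algebra_alg mcomplete_alg nrm_Cb_nonneg[OF Cb] nrm_eq_0_iff nrm_add_le smult mult cstar
      star_in mult_in add_in smult_in
    by (auto simp: restrict_eq_self mult_ac cong: restrict_cong)
qed

end

text \<open>Taking the whole of C_b(X) for \<open>S\<close> makes the metric lemmas of the locale
  available for the ambient algebra, in whose topology closedness is measured.\<close>

lemma closed_function_algebra_Cb: "closed_function_algebra X (carrier (Cb X))"
proof
  fix f g c assume f: "f \<in> carrier (Cb X)"
  obtain B where B: "\<And>x. x \<in> topspace X \<Longrightarrow> cmod (f x) \<le> B"
    using Cb_boundE[OF f] by blast
  show "(\<lambda>x\<in>topspace X. c * f x) \<in> carrier (Cb X)"
    using f B by (intro in_CbI[of _ _ "cmod c * B"])
      (auto simp: in_Cb_iff continuous_map_restrict norm_mult mult_left_mono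
        intro!: continuous_map_complex_mult)
  show "(\<lambda>x\<in>topspace X. cnj (f x)) \<in> carrier (Cb X)"
    using f B by (intro in_CbI[of _ _ B])
      (auto simp: in_Cb_iff continuous_map_restrict intro!: continuous_map_cnj)
  assume g: "g \<in> carrier (Cb X)"
  obtain B' where B': "\<And>x. x \<in> topspace X \<Longrightarrow> cmod (g x) \<le> B'"
    using Cb_boundE[OF g] by blast
  show "(\<lambda>x\<in>topspace X. f x + g x) \<in> carrier (Cb X)"
    using f g B B' by (intro in_CbI[of _ _ "B + B'"])
      (auto simp: in_Cb_iff continuous_map_restrict
        intro!: continuous_map_add norm_triangle_mono)
  show "(\<lambda>x\<in>topspace X. f x * g x) \<in> carrier (Cb X)"
    using f g B B' by (intro in_CbI[of _ _ "B * B'"])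
      (auto simp: in_Cb_iff continuous_map_restrict norm_mult
        intro!: continuous_map_complex_mult mult_mono intro: order_trans[OF norm_ge_zero])
next
  show "(\<lambda>x\<in>topspace X. 1) \<in> carrier (Cb X)"
    by (intro in_CbI[of _ _ 1]) (auto simp: continuous_map_restrict)
qed (auto intro: Cb_uniform_limit)

lemma unital_cstar_subalgebra_Cb_iff:
  "unital_cstar_subalgebra B (Cb X) \<longleftrightarrow>
    closed_function_algebra X (carrier B) \<and> B = (Cb X)\<lparr>carrier := carrier B\<rparr>"
proof -
  interpret Cb: closed_function_algebra X "carrier (Cb X)"
    by (rule closed_function_algebra_Cb)
  interpret M: Metric_space "carrier (Cb X)" "cstar_dist (Cb X)"
    using Cb.Metric_space_alg by simp
  have closed_iff: "closedin M.mtopology S \<longleftrightarrow>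
      (\<forall>g. g \<in> extensional (topspace X) \<longrightarrow>
        (\<forall>e>0. \<exists>f\<in>S. \<forall>x\<in>topspace X. cmod (f x - g x) < e) \<longrightarrow> g \<in> S)"
    (is "?closed \<longleftrightarrow> (\<forall>g. ?ext g \<longrightarrow> ?lim g \<longrightarrow> g \<in> S)")
    if S: "S \<subseteq> carrier (Cb X)" for S
  proof (intro iffI allI impI)
    fix g assume c: ?closed and g: "?ext g" "?lim g"
    \<comment> \<open>Metric closedness speaks only of points of C_b(X), so the limit has to be
      placed there first.\<close>
    have gC: "g \<in> carrier (Cb X)"
      using g S by (intro Cb_uniform_limit) blast+
    show "g \<in> S"
    proof (rule ccontr)
      assume "g \<notin> S"
      then obtain r where r: "r > 0" "disjnt S (M.mball g r)"
        using c gC unfolding M.closedin_metric by blast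
      \<comment> \<open>With pointwise error below \<open>r / 2\<close> the supremum is at most
        \<open>r / 2\<close>, hence strictly inside the ball of radius r.\<close>
      then obtain f where f: "f \<in> S" "\<forall>x\<in>topspace X. cmod (f x - g x) < r / 2"
        using g(2) half_gt_zero by blast
      have "cstar_dist (Cb X) g f \<le> r / 2"
        using Cb.cstar_dist_le[of "r / 2" g f] f(2) r(1)
        by (auto simp: norm_minus_commute less_imp_le)
      then show False
        using r f S gC by (auto simp: disjnt_iff)
    qed
  next
    assume lim: "\<forall>g. ?ext g \<longrightarrow> ?lim g \<longrightarrow> g \<in> S"
    show ?closed
      unfolding M.closedin_metric
    proof (intro conjI S allI impI)
      fix g assume g: "g \<in> carrier (Cb X) - S"
      then obtain e where e: "e > 0" "\<And>f. f \<in> S \<Longrightarrow> \<not> (\<forall>x\<in>topspace X. cmod (f x - g x) < e)"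
        using lim unfolding in_Cb_iff Diff_iff by blast
      have "disjnt S (M.mball g e)"
        using e(2) Cb.cstar_dist_less[of g _ e]
        by (auto simp: disjnt_iff norm_minus_commute)
      then show "\<exists>r>0. disjnt S (M.mball g r)"
        using e(1) by blast
    qed
  qed
  show ?thesis
  proof
    assume "unital_cstar_subalgebra B (Cb X)"
    then obtain S where S: "S \<subseteq> carrier (Cb X)" "B = (Cb X)\<lparr>carrier := S\<rparr>"
      "\<one>\<^bsub>Cb X\<^esub> \<in> S"
      "\<And>x y. x\<in>S \<Longrightarrow> y\<in>S \<Longrightarrow> x \<oplus>\<^bsub>Cb X\<^esub> y \<in> S \<and> x \<otimes>\<^bsub>Cb X\<^esub> y \<in> S"
      "\<And>c x. x\<in>S \<Longrightarrow> c \<odot>\<^bsub>Cb X\<^esub> x \<in> S"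
      "\<And>x. x\<in>S \<Longrightarrow> star (Cb X) x \<in> S"
      "closedin M.mtopology S"
      unfolding unital_cstar_subalgebra_def by blast
    have "closed_function_algebra X S"
    proof
      show "g \<in> S" if "g \<in> extensional (topspace X)"
        "\<And>e. 0 < e \<Longrightarrow> \<exists>f\<in>S. \<forall>x\<in>topspace X. cmod (f x - g x) < e" for g
        using S(7) that unfolding closed_iff[OF S(1)] by blast
    qed (use S in \<open>auto simp: Cb_sel\<close>)
    then show "closed_function_algebra X (carrier B) \<and> B = (Cb X)\<lparr>carrier := carrier B\<rparr>"
      using S(2) by simp
  next
    assume R: "closed_function_algebra X (carrier B) \<and> B = (Cb X)\<lparr>carrier := carrier B\<rparr>"
    then interpret B: closed_function_algebra X "carrier B" by simp
    have "closedin M.mtopology (carrier B)"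
      unfolding closed_iff[OF B.subset_Cb] using B.uniform_limit_in by blast
    then show "unital_cstar_subalgebra B (Cb X)"
      unfolding unital_cstar_subalgebra_def
      using R B.subset_Cb B.one_in B.add_in B.mult_in B.smult_in B.star_in
      by (intro exI[of _ "carrier B"]) (simp add: Cb_sel)
  qed
qed

section \<open>Characters and the Gelfand representation\<close>

text \<open>On extensional functions every coordinate outside I is the constant
  \<open>undefined\<close>, so it adds no open sets. Character spaces thereby become subspaces of a
  type-class topology, where \<open>continuous_on\<close> and Stone-Weierstrass apply.\<close>

lemma product_topology_euclidean_extensional:
  "product_topology (\<lambda>_. euclidean) I =
    top_of_set (extensional I :: ('i \<Rightarrow> 'b::topological_space) set)"
proof -
  let ?P = "product_topology (\<lambda>_. euclidean) I :: ('i \<Rightarrow> 'b) topology"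
  have top: "topspace ?P = extensional I"
    by (auto simp: PiE_def)
  have "continuous_map ?P euclidean (\<lambda>f. f i)" for i
  proof (cases "i \<in> I")
    case False
    have "continuous_map ?P euclidean (\<lambda>f. undefined)"
      by simp
    then show ?thesis
      by (rule continuous_map_eq) (use False top in \<open>auto simp: extensional_def\<close>)
  qed (rule continuous_map_product_projection)
  then have "continuous_map ?P (product_topology (\<lambda>_. euclidean) UNIV) (\<lambda>f. f)"
    by (intro continuous_map_coordinatewise_then_product) auto
  then have 1: "continuous_map ?P (top_of_set (extensional I)) id"
    by (auto simp: euclidean_product_topology continuous_map_in_subtopology PiE_def id_def)
  have 2: "continuous_map (top_of_set (extensional I)) ?P id"
    by (auto simp: continuous_map_componentwise id_def intro: continuous_on_product_then_coordinatewise)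
  show ?thesis
    using 1 2 homeomorphic_maps_id by (auto simp: homeomorphic_maps_def)
qed

lemma character_space_eq: "character_space A = top_of_set (characters A)"
  unfolding character_space_def product_topology_euclidean_extensional subtopology_subtopology
  by (rule arg_cong[where f = top_of_set]) (auto simp: characters_def)

lemma topspace_character_space [simp]: "topspace (character_space A) = characters A"
  by (simp add: character_space_eq)

lemma Hausdorff_character_space: "Hausdorff_space (character_space A)"
proof -
  have "Hausdorff_space (euclidean :: 'b::t2_space topology)"
    unfolding Hausdorff_space_def disjnt_def using hausdorff by (auto simp: open_openin[symmetric])
  then show ?thesis
    unfolding character_space_eq by (intro Hausdorff_space_subtopology)
qed

lemma continuous_map_character_space_apply:
  "continuous_map (character_space A) euclidean (\<lambda>\<xi>. \<xi> f)"
  unfolding character_space_eq continuous_map_iff_continuous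
  by (rule continuous_on_product_then_coordinatewise) (rule continuous_on_id)

lemma continuous_map_into_character_space:
  assumes "\<And>z. z \<in> topspace Z \<Longrightarrow> h z \<in> characters A"
    and "\<And>f. f \<in> carrier A \<Longrightarrow> continuous_map Z euclidean (\<lambda>z. h z f)"
  shows "continuous_map Z (character_space A) h"
  using assms unfolding character_space_def continuous_map_in_subtopology
  by (fastforce simp: continuous_map_componentwise characters_def)

context closed_function_algebra
begin

section \<open>Unitality, boundedness and self-adjointness of characters\<close>

context
  fixes \<xi> assumes \<xi>: "\<xi> \<in> characters alg"
begin

lemma char_add: "f \<in> S \<Longrightarrow> g \<in> S \<Longrightarrow> \<xi> (\<lambda>x\<in>topspace X. f x + g x) = \<xi> f + \<xi> g"
  and char_mult: "f \<in> S \<Longrightarrow> g \<in> S \<Longrightarrow> \<xi> (\<lambda>x\<in>topspace X. f x * g x) = \<xi> f * \<xi> g"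
  and char_smult: "f \<in> S \<Longrightarrow> \<xi> (\<lambda>x\<in>topspace X. c * f x) = c * \<xi> f"
  using \<xi> by (auto simp: characters_def)

text \<open>A character is only known to be nonzero somewhere. Evaluating c f once as a product and
  once as a scalar multiple, and cancelling a nonzero value, determines it on constants.\<close>

lemma char_const: "\<xi> (\<lambda>x\<in>topspace X. c) = c"
proof -
  obtain f where f: "f \<in> S" "\<xi> f \<noteq> 0"
    using \<xi> by (auto simp: characters_def)
  have "(\<lambda>x\<in>topspace X. (\<lambda>x\<in>topspace X. c) x * f x) = (\<lambda>x\<in>topspace X. c * f x)"
    by auto
  then have "\<xi> (\<lambda>x\<in>topspace X. c) * \<xi> f = c * \<xi> f"
    using char_mult[OF const_in f(1), of c] char_smult[OF f(1)] by (simp only:)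
  then show ?thesis
    using f(2) by simp
qed

lemma char_diff:
  assumes "f \<in> S" "g \<in> S"
  shows "\<xi> (\<lambda>x\<in>topspace X. f x - g x) = \<xi> f - \<xi> g"
proof -
  have "(\<lambda>x\<in>topspace X. f x + (\<lambda>x\<in>topspace X. -1 * g x) x) = (\<lambda>x\<in>topspace X. f x - g x)"
    by auto
  then show ?thesis
    using char_add[OF assms(1) smult_in[OF assms(2), of "-1"]] char_smult[OF assms(2), of "-1"]
    by simp
qed

text \<open>If \<open>\<xi> f\<close> exceeded the supremum of \<open>|f|\<close>, then \<open>g = f / \<xi> f\<close> would satisfy \<open>\<xi> g = 1\<close> while
  the geometric series \<open>b = g + g\<^sup>2 + \<dots>\<close> converges in \<open>S\<close>; but \<open>b = g + g b\<close>
  gives \<open>\<xi> b = 1 + \<xi> b\<close>.\<close>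

lemma char_bound:
  assumes f: "f \<in> S" and B: "0 \<le> B" "\<And>x. x \<in> topspace X \<Longrightarrow> cmod (f x) \<le> B"
  shows "cmod (\<xi> f) \<le> B"
proof (rule ccontr)
  assume "\<not> cmod (\<xi> f) \<le> B"
  then have less: "B < cmod (\<xi> f)" and nz: "\<xi> f \<noteq> 0"
    using B(1) by auto
  define r where "r = B / cmod (\<xi> f)"
  have r: "0 \<le> r" "r < 1"
    using less B(1) nz by (auto simp: r_def divide_less_eq)
  define g where "g = (\<lambda>x\<in>topspace X. inverse (\<xi> f) * f x)"
  have g: "g \<in> S" and \<xi>g: "\<xi> g = 1"
    using smult_in[OF f] char_smult[OF f] nz by (auto simp: g_def)
  have gr: "cmod (g x) \<le> r" if "x \<in> topspace X" for x
    using B(2)[OF that] that by (simp add: g_def r_def norm_mult norm_inverse divide_inverse mult.commute mult_right_mono)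
  have g1: "g x \<noteq> 1" if "x \<in> topspace X" for x
    using gr[OF that] r by auto
  define b where "b = (\<lambda>x\<in>topspace X. g x / (1 - g x))"
  \<comment> \<open>Closed form of the partial sum g + ... + g^n, the empty sum for n = 0;
    \<open>b\<close> is the closed form of the whole series.\<close>
  define s where "s n = (\<lambda>x\<in>topspace X. (g x - g x ^ Suc n) / (1 - g x))" for n
  have s: "s n \<in> S" for n
  proof (induction n)
    case 0
    have "s 0 = (\<lambda>x\<in>topspace X. 0)"
      by (auto simp: s_def)
    then show ?case
      by (simp only: const_in)
  next
    case (Suc n)
    have "s (Suc n) = (\<lambda>x\<in>topspace X. g x + (\<lambda>x\<in>topspace X. g x * s n x) x)"
      using g1 by (auto simp: s_def fun_eq_iff divide_simps) (auto simp: algebra_simps)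
    then show ?case
      using add_in[OF g mult_in[OF g Suc]] by (simp only:)
  qed
  have b: "b \<in> S"
  proof (rule uniform_limit_in)
    show "b \<in> extensional (topspace X)"
      by (simp add: b_def)
    fix e :: real assume e: "0 < e"
    \<comment> \<open>The tail of the series is at most \<open>r ^ n / (1 - r)\<close> in modulus,
      uniformly on X.\<close>
    obtain n where n: "r ^ n < e * (1 - r)"
      using real_arch_pow_inv[of "e * (1 - r)" r] e r by auto
    have "cmod (s n x - b x) < e" if x: "x \<in> topspace X" for x
    proof -
      have "s n x - b x = - (g x ^ Suc n / (1 - g x))"
        using x by (simp add: s_def b_def diff_divide_distrib)
      then have "cmod (s n x - b x) = cmod (g x) ^ Suc n / cmod (1 - g x)"
        by (simp add: norm_divide norm_power norm_mult)
      also have "\<dots> \<le> r ^ n / (1 - r)"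
      proof (rule frac_le)
        have "cmod (g x) ^ Suc n \<le> r ^ Suc n"
          using gr[OF x] by (intro power_mono) auto
        also have "\<dots> \<le> r ^ n"
          using r by (intro power_decreasing) auto
        finally show "cmod (g x) ^ Suc n \<le> r ^ n" .
        show "1 - r \<le> cmod (1 - g x)"
          using gr[OF x] norm_triangle_ineq2[of 1 "g x"] by simp
      qed (use r in auto)
      also have "\<dots> < e"
        using n r by (simp add: divide_less_eq)
      finally show ?thesis .
    qed
    then show "\<exists>f\<in>S. \<forall>x\<in>topspace X. cmod (f x - b x) < e"
      using s by blast
  qed
  have "b = (\<lambda>x\<in>topspace X. g x + (\<lambda>x\<in>topspace X. g x * b x) x)"
    using g1 by (auto simp: b_def fun_eq_iff divide_simps) (auto simp: algebra_simps)
  then have "\<xi> b = 1 + \<xi> b"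
    using char_add[OF g mult_in[OF g b]] char_mult[OF g b] \<xi>g by simp
  then show False
    by simp
qed

text \<open>Shift f by the imaginary constant it. The supremum bound for the squared modulus is N^2
  + t^2, but the value at \<open>\<xi>\<close> contributes (b + t)^2, whose cross term 2bt is
  unbounded in t unless b = 0.\<close>

lemma Im_char_real:
  assumes f: "f \<in> S" and real: "\<And>x. x \<in> topspace X \<Longrightarrow> Im (f x) = 0"
  shows "Im (\<xi> f) = 0"
proof (rule ccontr)
  define a b where "a = Re (\<xi> f)" and "b = Im (\<xi> f)"
  assume "Im (\<xi> f) \<noteq> 0"
  then have b0: "b \<noteq> 0"
    by (simp add: b_def)
  obtain N where N: "\<And>x. x \<in> topspace X \<Longrightarrow> cmod (f x) \<le> N"
    using Cb_boundE f subset_Cb by blast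
  \<comment> \<open>Chosen so that 2bt = N^2 + 1, just beyond the bound; the sign of b is absorbed
    into t.\<close>
  define t where "t = (N\<^sup>2 + 1) / (2 * b)"
  define h where "h = (\<lambda>x\<in>topspace X. f x + (\<lambda>x\<in>topspace X. \<i> * complex_of_real t) x)"
  have h: "h \<in> S" and \<xi>h: "\<xi> h = \<xi> f + \<i> * complex_of_real t"
    using add_in[OF f const_in] char_add[OF f const_in] char_const by (simp_all add: h_def)
  have "cmod (\<xi> h) \<le> sqrt (N\<^sup>2 + t\<^sup>2)"
  proof (rule char_bound[OF h])
    fix x assume x: "x \<in> topspace X"
    have "(Re (f x))\<^sup>2 \<le> N\<^sup>2"
      using power_mono[OF N[OF x], of 2] real[OF x] by (simp add: cmod_power2)
    then show "cmod (h x) \<le> sqrt (N\<^sup>2 + t\<^sup>2)"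
      using x real[OF x] by (simp add: h_def cmod_def)
  qed simp
  then have "a\<^sup>2 + (b + t)\<^sup>2 \<le> N\<^sup>2 + t\<^sup>2"
    by (simp add: cmod_def \<xi>h a_def b_def)
  then have "b\<^sup>2 + 2 * b * t \<le> N\<^sup>2"
    using zero_le_power2[of a] unfolding power2_sum by linarith
  moreover have "2 * b * t = N\<^sup>2 + 1"
    using b0 by (simp add: t_def)
  ultimately show False
    using zero_le_power2[of b] by linarith
qed

text \<open>Both f + cnj f and i (f - cnj f) are real-valued, so \<open>Im_char_real\<close> applies
  to them and yields the imaginary and the real part of the identity.\<close>

lemma char_star:
  assumes f: "f \<in> S"
  shows "\<xi> (\<lambda>x\<in>topspace X. cnj (f x)) = cnj (\<xi> f)"
proof -
  let ?f = "\<lambda>x\<in>topspace X. cnj (f x)"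
  have f': "?f \<in> S"
    by (rule star_in[OF f])
  have "Im (\<xi> (\<lambda>x\<in>topspace X. f x + ?f x)) = 0"
    using add_in[OF f f'] by (rule Im_char_real) simp
  then have 1: "Im (\<xi> f) + Im (\<xi> ?f) = 0"
    by (simp only: char_add[OF f f'] plus_complex.sel)
  have d: "(\<lambda>x\<in>topspace X. f x - ?f x) \<in> S"
    by (rule diff_in[OF f f'])
  have "Im (\<xi> (\<lambda>x\<in>topspace X. \<i> * (\<lambda>x\<in>topspace X. f x - ?f x) x)) = 0"
    using smult_in[OF d] by (rule Im_char_real) simp
  then have "Im (\<i> * (\<xi> f - \<xi> ?f)) = 0"
    by (simp only: char_smult[OF d] char_diff[OF f f'])
  then have 2: "Re (\<xi> f) = Re (\<xi> ?f)"
    by simp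
  show ?thesis
    using 1 2 by (simp add: complex_eq_iff)
qed

end

section \<open>Evaluations and their density among the characters\<close>

definition ev :: "'a \<Rightarrow> ('a \<Rightarrow> complex) \<Rightarrow> complex" where
  "ev x = (\<lambda>g\<in>S. g x)"

lemma ev_apply [simp]: "g \<in> S \<Longrightarrow> ev x g = g x"
  by (simp add: ev_def)

lemma ev_in: "x \<in> topspace X \<Longrightarrow> ev x \<in> characters alg"
  using add_in mult_in smult_in one_in
  by (auto simp: characters_def ev_def intro!: bexI[OF _ one_in])

lemma continuous_map_ev: "continuous_map X (character_space alg) ev"
  by (rule continuous_map_into_character_space)
    (use subset_Cb in \<open>auto simp: ev_in in_Cb_iff\<close>)

text \<open>A basic neighbourhood of \<open>\<xi>\<close> restricts finitely many coordinates. The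
  sum of the functions |i - \<xi> i|^2 lies in \<open>S\<close> and measures all of them at once; by
  \<open>char_star\<close>, every character evaluates it as the displayed sum of squares.\<close>

lemma ex_square_distance:
  assumes "finite J" "J \<subseteq> S" and \<xi>: "\<xi> \<in> characters alg"
  shows "\<exists>f\<in>S. \<forall>\<zeta>\<in>characters alg. \<zeta> f = complex_of_real (\<Sum>i\<in>J. (cmod (\<zeta> i - \<xi> i))\<^sup>2)"
  using assms(1,2)
proof (induction J)
  case empty
  then show ?case
    using char_const[where c = 0] const_in by (intro bexI[of _ "\<lambda>x\<in>topspace X. 0"]) (simp_all only: sum.empty of_real_0 ball_simps, blast)
next
  case (insert i J)
  then obtain f where f: "f \<in> S"
    "\<And>\<zeta>. \<zeta> \<in> characters alg \<Longrightarrow> \<zeta> f = complex_of_real (\<Sum>i\<in>J. (cmod (\<zeta> i - \<xi> i))\<^sup>2)"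
    by auto
  have i: "i \<in> S"
    using insert by auto
  define h where "h = (\<lambda>x\<in>topspace X. i x - (\<lambda>x\<in>topspace X. \<xi> i) x)"
  have h: "h \<in> S"
    unfolding h_def by (rule diff_in[OF i const_in])
  note hh = mult_in[OF h star_in[OF h]]
  have "\<zeta> (\<lambda>x\<in>topspace X. f x + (\<lambda>x\<in>topspace X. h x * (\<lambda>x\<in>topspace X. cnj (h x)) x) x) =
      complex_of_real (\<Sum>i\<in>insert i J. (cmod (\<zeta> i - \<xi> i))\<^sup>2)" if \<zeta>: "\<zeta> \<in> characters alg" for \<zeta>
  proof -
    have "\<zeta> h = \<zeta> i - \<xi> i"
      unfolding h_def by (simp only: char_diff[OF \<zeta> i const_in] char_const[OF \<zeta>])
    then show ?thesis
      unfolding char_add[OF \<zeta> f(1) hh] char_mult[OF \<zeta> h star_in[OF h]] char_star[OF \<zeta> h] f(2)[OF \<zeta>]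
      unfolding sum.insert[OF insert.hyps(1,2)] of_real_add complex_norm_square[of "\<zeta> i - \<xi> i"]
      by (simp only: add.commute)
  qed
  then show ?case
    using add_in[OF f(1) hh] by blast
qed

text \<open>Replaces an arbitrary neighbourhood by a sublevel set of a single nonnegative f in
  \<open>S\<close> that vanishes at \<open>\<xi>\<close>. Nonnegativity on X is inherited from the
  sum of squares via evaluations.\<close>

lemma character_space_nbhd:
  assumes U: "openin (character_space alg) U" and \<xi>: "\<xi> \<in> U"
  obtains f e where "f \<in> S" "0 < e" "\<xi> f = 0"
    "\<And>x. x \<in> topspace X \<Longrightarrow> f x = complex_of_real (cmod (f x))"
    "\<And>\<zeta>. \<zeta> \<in> characters alg \<Longrightarrow> cmod (\<zeta> f) < e \<Longrightarrow> \<zeta> \<in> U"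
proof -
  obtain W where W: "openin (product_topology (\<lambda>_. euclidean) S) W" "U = W \<inter> characters alg"
    using U by (auto simp: character_space_def openin_subtopology)
  have \<xi>c: "\<xi> \<in> characters alg"
    using \<xi> W by auto
  obtain V where V: "\<xi> \<in> Pi\<^sub>E S V" "\<And>i. open (V i)" "finite {i. V i \<noteq> UNIV}" "Pi\<^sub>E S V \<subseteq> W"
    using product_topology_open_contains_basis[OF W(1), of \<xi>] \<xi> W(2)
    by (simp only: open_openin[symmetric] topspace_euclidean) blast
  define J where "J = {i. V i \<noteq> UNIV} \<inter> S"
  have J: "finite J" "J \<subseteq> S"
    using V(3) by (auto simp: J_def)
  have "\<exists>e>0. ball (\<xi> i) e \<subseteq> V i" if "i \<in> J" for i
  proof -
    have "\<xi> i \<in> V i"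
      using V(1) that J by auto
    then show ?thesis
      using V(2) open_contains_ball by blast
  qed
  then obtain d where d: "\<And>i. i \<in> J \<Longrightarrow> 0 < d i" "\<And>i. i \<in> J \<Longrightarrow> ball (\<xi> i) (d i) \<subseteq> V i"
    by metis
  \<comment> \<open>The inserted 1 keeps the minimum defined and positive when no coordinate is
    restricted.\<close>
  define e where "e = Min (insert 1 ((\<lambda>i. (d i)\<^sup>2) ` J))"
  have e: "0 < e" "\<And>i. i \<in> J \<Longrightarrow> e \<le> (d i)\<^sup>2"
    using J(1) d(1) by (auto simp: e_def) (metis less_irrefl)
  obtain f where f: "f \<in> S"
    "\<And>\<zeta>. \<zeta> \<in> characters alg \<Longrightarrow> \<zeta> f = complex_of_real (\<Sum>i\<in>J. (cmod (\<zeta> i - \<xi> i))\<^sup>2)"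
    using ex_square_distance[OF J \<xi>c] by blast
  show thesis
  proof
    show "f \<in> S" "0 < e"
      by fact+
    show "\<xi> f = 0"
      using f(2)[OF \<xi>c] by simp
    show "f x = complex_of_real (cmod (f x))" if "x \<in> topspace X" for x
    proof -
      have *: "f x = complex_of_real (\<Sum>i\<in>J. (cmod (ev x i - \<xi> i))\<^sup>2)"
        using f(2)[OF ev_in[OF that]] f(1) by simp
      show ?thesis
        unfolding * norm_of_real by (simp add: sum_nonneg)
    qed
    fix \<zeta> assume \<zeta>: "\<zeta> \<in> characters alg" "cmod (\<zeta> f) < e"
    have "\<zeta> i \<in> V i" if i: "i \<in> S" for i
    proof (cases "i \<in> J")
      case True
      have "(cmod (\<zeta> i - \<xi> i))\<^sup>2 \<le> (\<Sum>i\<in>J. (cmod (\<zeta> i - \<xi> i))\<^sup>2)"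
        using True J(1) by (intro member_le_sum) auto
      also have "\<dots> = cmod (\<zeta> f)"
        unfolding f(2)[OF \<zeta>(1)] norm_of_real by (simp add: sum_nonneg)
      also have "\<dots> < (d i)\<^sup>2"
        using \<zeta>(2) e(2)[OF True] by simp
      finally have "cmod (\<zeta> i - \<xi> i) < d i"
        using d(1)[OF True] by (simp add: power_less_imp_less_base)
      then show ?thesis
        using d(2)[OF True] by (auto simp: dist_norm norm_minus_commute)
    next
      case False
      then show ?thesis
        using i by (auto simp: J_def)
    qed
    then have "\<zeta> \<in> Pi\<^sub>E S V"
      using \<zeta>(1) by (auto simp: characters_def PiE_def)
    then show "\<zeta> \<in> U"
      using V(4) W(2) \<zeta>(1) by auto
  qed
qed

text \<open>If a neighbourhood of \<open>\<xi>\<close> contained no evaluation, its function f would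
  be at least e on X, so B - f would be bounded by B - e. But f vanishes at \<open>\<xi>\<close>, so
  B - f takes the value B there, against \<open>char_bound\<close>.\<close>

lemma ev_dense: "character_space alg closure_of (ev ` topspace X) = characters alg"
proof
  show "character_space alg closure_of (ev ` topspace X) \<subseteq> characters alg"
    using closure_of_subset_topspace[of "character_space alg"] by simp
  show "characters alg \<subseteq> character_space alg closure_of (ev ` topspace X)"
  proof
    fix \<xi> assume \<xi>: "\<xi> \<in> characters alg"
    have "\<exists>x\<in>topspace X. ev x \<in> U" if U: "openin (character_space alg) U" "\<xi> \<in> U" for U
    proof (rule ccontr)
      assume no: "\<not> (\<exists>x\<in>topspace X. ev x \<in> U)"
      obtain f e where f: "f \<in> S" "0 < e" "\<xi> f = 0"
        and pos: "\<And>x. x \<in> topspace X \<Longrightarrow> f x = complex_of_real (cmod (f x))"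
        and U': "\<And>\<zeta>. \<zeta> \<in> characters alg \<Longrightarrow> cmod (\<zeta> f) < e \<Longrightarrow> \<zeta> \<in> U"
        by (rule character_space_nbhd[OF U]) blast
      have fe: "e \<le> cmod (f x)" if "x \<in> topspace X" for x
        using no U'[OF ev_in[OF that]] that f(1) by fastforce
      obtain B0 where B0: "\<And>x. x \<in> topspace X \<Longrightarrow> cmod (f x) \<le> B0"
        using Cb_boundE f(1) subset_Cb by blast
      \<comment> \<open>The maximum with e ensures \<open>0 \<le> B - e\<close>, as
        \<open>char_bound\<close> requires.\<close>
      define B where "B = max B0 e"
      have B: "\<And>x. x \<in> topspace X \<Longrightarrow> cmod (f x) \<le> B" "e \<le> B"
        using B0 by (auto simp: B_def le_max_iff_disj)
      let ?h = "\<lambda>x\<in>topspace X. (\<lambda>x\<in>topspace X. complex_of_real B) x - f x"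
      have "cmod (\<xi> ?h) \<le> B - e"
      proof (rule char_bound[OF \<xi> diff_in[OF const_in f(1)]])
        fix x assume x: "x \<in> topspace X"
        have "?h x = complex_of_real (B - cmod (f x))"
          using x pos[OF x] by simp
        then show "cmod (?h x) \<le> B - e"
          using B(1)[OF x] fe[OF x] by (simp only: norm_of_real)
      qed (use B in auto)
      moreover have "\<xi> ?h = complex_of_real B"
        by (simp only: char_diff[OF \<xi> const_in f(1)] char_const[OF \<xi>] f(3) diff_zero)
      ultimately show False
        using f(2) B(2) by simp
    qed
    then show "\<xi> \<in> character_space alg closure_of (ev ` topspace X)"
      using \<xi> by (auto simp: in_closure_of)
  qed
qed

text \<open>Stone-Weierstrass approximates k by real Gelfand transforms. Restricted along
  \<open>ev\<close> the approximants converge uniformly on X, so their limit lies in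
  \<open>S\<close>; \<open>char_bound\<close> then carries the estimate from X back to all
  characters.\<close>

lemma Gelfand_surj_real:
  fixes k :: "(('a \<Rightarrow> complex) \<Rightarrow> complex) \<Rightarrow> real"
  assumes compact: "compact_space (character_space alg)"
    and k: "continuous_map (character_space alg) euclidean k"
  obtains g where "g \<in> S" "\<And>\<xi>. \<xi> \<in> characters alg \<Longrightarrow> \<xi> g = complex_of_real (k \<xi>)"
proof -
  define R where "R = {r. \<exists>f\<in>S. \<forall>\<xi>\<in>characters alg. \<xi> f = complex_of_real (r \<xi>)}"
  interpret function_ring_on R "characters alg"
  proof
    show "compact (characters alg)"
      using compact compactin_subspace[of euclidean "characters alg"] by (simp add: character_space_eq)
    show "continuous_on (characters alg) r" if r: "r \<in> R" for r
    proof -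
      obtain f where "\<forall>\<xi>\<in>characters alg. \<xi> f = complex_of_real (r \<xi>)"
        using r unfolding R_def by blast
      then have "r \<xi> = Re (\<xi> f)" if "\<xi> \<in> characters alg" for \<xi>
        using that by (metis Re_complex_of_real)
      moreover have "continuous_on (characters alg) (\<lambda>\<xi>. Re (\<xi> f))"
        using continuous_map_character_space_apply[of alg f]
        by (simp add: character_space_eq continuous_on_Re)
      ultimately show ?thesis
        by (simp cong: continuous_on_cong)
    qed
    show "(\<lambda>_. c) \<in> R" for c
      unfolding R_def using const_in char_const by blast
    fix r s assume "r \<in> R" "s \<in> R"
    then obtain f g where f: "f \<in> S" "\<forall>\<xi>\<in>characters alg. \<xi> f = complex_of_real (r \<xi>)"
      and g: "g \<in> S" "\<forall>\<xi>\<in>characters alg. \<xi> g = complex_of_real (s \<xi>)"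
      unfolding R_def by blast
    show "(\<lambda>\<xi>. r \<xi> + s \<xi>) \<in> R"
      unfolding R_def using add_in[OF f(1) g(1)] char_add[OF _ f(1) g(1)] f(2) g(2)
      by (intro CollectI bexI) auto
    show "(\<lambda>\<xi>. r \<xi> * s \<xi>) \<in> R"
      unfolding R_def using mult_in[OF f(1) g(1)] char_mult[OF _ f(1) g(1)] f(2) g(2)
      by (intro CollectI bexI) auto
  next
    fix \<xi> \<zeta> assume \<xi>: "\<xi> \<in> characters alg" and \<zeta>: "\<zeta> \<in> characters alg" and "\<xi> \<noteq> \<zeta>"
    then obtain f where f: "f \<in> S" "\<xi> f \<noteq> \<zeta> f"
      using extensionalityI[of \<xi> S \<zeta>] by (auto simp: characters_def)
    \<comment> \<open>The separating f need not have a real transform; the squared distance of its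
      values from \<open>\<xi> f\<close> is real, vanishes at \<open>\<xi>\<close> and not at
      \<open>\<zeta>\<close>.\<close>
    obtain h where h: "h \<in> S" "\<forall>\<upsilon>\<in>characters alg. \<upsilon> h = complex_of_real (\<Sum>i\<in>{f}. (cmod (\<upsilon> i - \<xi> i))\<^sup>2)"
      using ex_square_distance[of "{f}", OF _ _ \<xi>] f(1) by auto
    then have "(\<lambda>\<upsilon>. (cmod (\<upsilon> f - \<xi> f))\<^sup>2) \<in> R"
      unfolding R_def by auto
    then show "\<exists>r\<in>R. r \<xi> \<noteq> r \<zeta>"
      using f(2) by (intro bexI) auto
  qed
  define g where "g = (\<lambda>x\<in>topspace X. complex_of_real (k (ev x)))"
  have kc: "continuous_on (characters alg) k"
    using k by (simp add: character_space_eq)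
  have approx: "\<exists>f\<in>S. \<forall>\<xi>\<in>characters alg. cmod (\<xi> f - complex_of_real (k \<xi>)) < e" if e: "0 < e" for e
  proof -
    obtain r where r: "r \<in> R" "\<forall>\<xi>\<in>characters alg. \<bar>k \<xi> - r \<xi>\<bar> < e"
      using Stone_Weierstrass_basic[OF kc e] by blast
    then obtain f where f: "f \<in> S" "\<forall>\<xi>\<in>characters alg. \<xi> f = complex_of_real (r \<xi>)"
      unfolding R_def by blast
    have "cmod (\<xi> f - complex_of_real (k \<xi>)) < e" if "\<xi> \<in> characters alg" for \<xi>
    proof -
      have "\<xi> f - complex_of_real (k \<xi>) = complex_of_real (r \<xi> - k \<xi>)"
        using f(2) that by simp
      then show ?thesis
        using r(2) that by (simp only: norm_of_real abs_minus_commute)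
    qed
    then show ?thesis
      using f(1) by blast
  qed
  have near: "cmod (f x - g x) < e"
    if "f \<in> S" "\<forall>\<xi>\<in>characters alg. cmod (\<xi> f - complex_of_real (k \<xi>)) < e" "x \<in> topspace X" for f e x
    using that ev_in[OF that(3)] by (auto simp: g_def)
  have gS: "g \<in> S"
  proof (rule uniform_limit_in)
    show "g \<in> extensional (topspace X)"
      by (simp add: g_def)
    show "\<exists>f\<in>S. \<forall>x\<in>topspace X. cmod (f x - g x) < e" if "0 < e" for e
      using approx[OF that] near by blast
  qed
  moreover have "\<xi> g = complex_of_real (k \<xi>)" if \<xi>: "\<xi> \<in> characters alg" for \<xi>
  proof -
    have "cmod (\<xi> g - complex_of_real (k \<xi>)) \<le> e" if e: "0 < e" for e
    proof -
      obtain f where f: "f \<in> S" "\<forall>\<xi>\<in>characters alg. cmod (\<xi> f - complex_of_real (k \<xi>)) < e / 2"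
        using approx[of "e / 2"] e by auto
      \<comment> \<open>The approximation of g by f is known only at evaluations; contractivity
        extends it to \<open>\<xi>\<close>.\<close>
      have "cmod (\<xi> (\<lambda>x\<in>topspace X. f x - g x)) \<le> e / 2"
        using near[OF f] e by (intro char_bound[OF \<xi> diff_in[OF f(1) gS]]) (auto simp: less_imp_le)
      then have "cmod (\<xi> f - \<xi> g) \<le> e / 2"
        by (simp only: char_diff[OF \<xi> f(1) gS])
      moreover have "cmod (\<xi> f - complex_of_real (k \<xi>)) < e / 2"
        using f(2) \<xi> by blast
      ultimately show ?thesis
        using norm_triangle_ineq[of "\<xi> f - complex_of_real (k \<xi>)" "\<xi> g - \<xi> f"]
        by (simp add: norm_minus_commute)
    qed
    then have "cmod (\<xi> g - complex_of_real (k \<xi>)) \<le> 0"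
      by (rule field_le_epsilon) simp
    then show ?thesis
      by simp
  qed
  ultimately show thesis
    by (rule that)
qed

lemma Gelfand_surj:
  assumes compact: "compact_space (character_space alg)"
    and k: "continuous_map (character_space alg) euclidean k"
  shows "\<exists>g\<in>S. \<forall>\<xi>\<in>characters alg. \<xi> g = k \<xi>"
proof -
  have "continuous_map (character_space alg) euclidean (\<lambda>\<xi>. Re (k \<xi>))"
    and "continuous_map (character_space alg) euclidean (\<lambda>\<xi>. Im (k \<xi>))"
    using k by (simp_all add: continuous_map_atin tendsto_Re tendsto_Im)
  note ReIm = this
  obtain u where u: "u \<in> S" "\<And>\<xi>. \<xi> \<in> characters alg \<Longrightarrow> \<xi> u = complex_of_real (Re (k \<xi>))"
    by (rule Gelfand_surj_real[OF compact ReIm(1)]) blast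
  obtain v where v: "v \<in> S" "\<And>\<xi>. \<xi> \<in> characters alg \<Longrightarrow> \<xi> v = complex_of_real (Im (k \<xi>))"
    by (rule Gelfand_surj_real[OF compact ReIm(2)]) blast
  note iv = smult_in[OF v(1), of \<i>]
  have "\<xi> (\<lambda>x\<in>topspace X. u x + (\<lambda>x\<in>topspace X. \<i> * v x) x) = k \<xi>" if \<xi>: "\<xi> \<in> characters alg" for \<xi>
    unfolding char_add[OF \<xi> u(1) iv] char_smult[OF \<xi> v(1)] u(2)[OF \<xi>] v(2)[OF \<xi>]
    by (rule complex_eq[symmetric])
  then show ?thesis
    using add_in[OF u(1) iv] by blast
qed

end

section \<open>Evaluation maps, isomorphic algebras, and dense maps into compact spaces\<close>

lemma (in closed_function_algebra) inj_on_ev_iff: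
  "inj_on ev (topspace X) \<longleftrightarrow> separates_points X S"
proof -
  have *: "ev x = ev y \<longleftrightarrow> (\<forall>f\<in>S. f x = f y)" for x y
    by (auto simp: ev_def fun_eq_iff restrict_def)
  then show ?thesis
    unfolding inj_on_def separates_points_def * by (intro ball_cong refl) auto
qed

text \<open>For an embedding, the complement of E is cut out by an open set of characters, and
  \<open>character_space_nbhd\<close> turns that set into a separating function. Conversely, such
  functions make \<open>ev\<close> closed onto its image; closed points give injectivity.\<close>

lemma (in closed_function_algebra) embedding_map_ev_iff:
  assumes "t1_space X"
  shows "embedding_map X (character_space alg) ev \<longleftrightarrow> separates_points_closed_sets X S"
proof
  assume emb: "embedding_map X (character_space alg) ev"
  show "separates_points_closed_sets X S"
    unfolding separates_points_closed_sets_def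
  proof (intro allI impI ballI)
    fix E x assume E: "closedin X E" and x: "x \<in> topspace X - E"
    have inj: "inj_on ev (topspace X)"
      and "open_map X (subtopology (character_space alg) (ev ` topspace X)) ev"
      using emb unfolding embedding_map_def homeomorphic_eq_everything_map by blast+
    then have "openin (subtopology (character_space alg) (ev ` topspace X)) (ev ` (topspace X - E))"
      using openin_diff[OF openin_topspace E] unfolding open_map_def by blast
    then have "\<exists>W. openin (character_space alg) W \<and> ev ` (topspace X - E) = W \<inter> ev ` topspace X"
      unfolding openin_subtopology .
    then obtain W where W: "openin (character_space alg) W" "ev ` (topspace X - E) = W \<inter> ev ` topspace X"
      by (elim exE conjE)
    have "ev x \<in> W"
      using W(2) x by blast
    then obtain f e where f: "f \<in> S" "0 < e" "ev x f = 0"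
      and W': "\<And>\<zeta>. \<zeta> \<in> characters alg \<Longrightarrow> cmod (\<zeta> f) < e \<Longrightarrow> \<zeta> \<in> W"
      using character_space_nbhd[OF W(1)] by metis
    \<comment> \<open>A smaller value would put \<open>ev y\<close> into W, hence among the images
      of points off E, contradicting injectivity.\<close>
    have "e \<le> cmod (f y)" if y: "y \<in> E" for y
    proof (rule ccontr)
      have yX: "y \<in> topspace X"
        using E y closedin_subset by blast
      assume "\<not> e \<le> cmod (f y)"
      then have "ev y \<in> W"
        using W'[OF ev_in[OF yX]] f(1) by simp
      then have "ev y \<in> ev ` (topspace X - E)"
        using W(2) yX by blast
      then show False
        using inj yX y by (auto dest: inj_onD)
    qed
    then have "closure (f ` E) \<subseteq> - ball 0 e"
      by (intro closure_minimal) (auto simp: not_less image_subset_iff closed_Compl)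
    then have "f x \<notin> closure (f ` E)"
      using f by auto
    then show "\<exists>f\<in>S. f x \<notin> closure (f ` E)"
      using f(1) by blast
  qed
next
  assume sep: "separates_points_closed_sets X S"
  let ?\<Phi> = "subtopology (character_space alg) (ev ` topspace X)"
  have inj: "inj_on ev (topspace X)"
    unfolding inj_on_ev_iff separates_points_def
  proof (intro ballI impI)
    fix x y assume xy: "x \<in> topspace X" "y \<in> topspace X" "x \<noteq> y"
    then have "closedin X {y}"
      using assms by (simp add: closedin_t1_singleton)
    then obtain f where "f \<in> S" "f x \<notin> closure (f ` {y})"
      using sep xy unfolding separates_points_closed_sets_def by blast
    then show "\<exists>f\<in>S. f x \<noteq> f y"
      by auto
  qed
  have "closedin ?\<Phi> (ev ` E)" if E: "closedin X E" for E
  proof -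
    have EX: "E \<subseteq> topspace X"
      using E by (rule closedin_subset)
    let ?C = "character_space alg closure_of (ev ` E)"
    have "ev ` E = ?C \<inter> ev ` topspace X"
    proof
      show "ev ` E \<subseteq> ?C \<inter> ev ` topspace X"
        using EX ev_in closure_of_subset[of "ev ` E" "character_space alg"] by auto
      show "?C \<inter> ev ` topspace X \<subseteq> ev ` E"
      proof clarify
        fix x assume x: "x \<in> topspace X" "ev x \<in> ?C"
        have "x \<in> E"
        proof (rule ccontr)
          assume "x \<notin> E"
          then obtain f where f: "f \<in> S" "f x \<notin> closure (f ` E)"
            using sep E x(1) unfolding separates_points_closed_sets_def by blast
          \<comment> \<open>An open set of characters around \<open>ev x\<close> that contains no
            evaluation at a point of E.\<close>
          define V where "V = {\<xi> \<in> topspace (character_space alg). \<xi> f \<in> - closure (f ` E)}"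
          have "openin (character_space alg) V"
            unfolding V_def
            by (intro openin_continuous_map_preimage[OF continuous_map_character_space_apply])
              (simp add: open_openin[symmetric] open_Compl)
          moreover have "ev x \<in> V"
            using f ev_in[OF x(1)] by (simp add: V_def)
          ultimately have "\<exists>\<zeta>. \<zeta> \<in> ev ` E \<and> \<zeta> \<in> V"
            using x(2) unfolding in_closure_of by blast
          then obtain y where "y \<in> E" "ev y f \<in> - closure (f ` E)"
            by (auto simp: V_def)
          then show False
            using f(1) closure_subset[of "f ` E"] by auto
        qed
        then show "ev x \<in> ev ` E"
          by blast
      qed
    qed
    then show ?thesis
      unfolding closedin_subtopology by (intro exI[of _ ?C]) simp
  qed
  then have "closed_map X ?\<Phi> ev"
    by (simp add: closed_map_def)
  moreover have "continuous_map X ?\<Phi> ev"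
    using continuous_map_ev by (simp add: continuous_map_in_subtopology)
  moreover have "ev ` topspace X = topspace ?\<Phi>"
    using ev_in by auto
  ultimately show "embedding_map X (character_space alg) ev"
    unfolding embedding_map_def using inj by (intro bijective_closed_imp_homeomorphic_map)
qed

text \<open>K is a common model of both character spaces, which inherit its compactness. The
  assumptions are symmetric in the two algebras, so the inverse of every map built here comes from
  the swapped pair.\<close>

locale Gelfand_dual_pair =
  A: closed_function_algebra X S + B: closed_function_algebra Y T
  for X :: "'a topology" and S and Y :: "'b topology" and T +
  fixes K :: "'k topology" and a and b
  assumes compact: "compact_space K"
    and hom_a: "homeomorphic_map K (character_space A.alg) a"
    and hom_b: "homeomorphic_map K (character_space B.alg) b"
begin

lemma a_image: "a ` topspace K = characters A.alg"
  and b_image: "b ` topspace K = characters B.alg"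
  using homeomorphic_imp_surjective_map[OF hom_a] homeomorphic_imp_surjective_map[OF hom_b] by auto

lemma a_char: "p \<in> topspace K \<Longrightarrow> a p \<in> characters A.alg"
  and b_char: "p \<in> topspace K \<Longrightarrow> b p \<in> characters B.alg"
  using a_image b_image by auto

text \<open>Every evaluation occurs among the characters \<open>b p\<close>, so these already
  separate the elements of \<open>T\<close>.\<close>

lemma eq_if_chars_eq:
  assumes "h \<in> T" "h' \<in> T" "\<And>p. p \<in> topspace K \<Longrightarrow> b p h = b p h'"
  shows "h = h'"
proof (rule extensionalityI[OF B.ext B.ext])
  fix y assume "y \<in> topspace Y"
  then obtain p where "p \<in> topspace K" "B.ev y = b p"
    using B.ev_in b_image by blast
  then show "h y = h' y"
    using assms B.ev_apply by metis
qed fact+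

text \<open>Carried over by the inverse of b, the function p -> \<open>a p g\<close> is continuous
  on a compact character space, so \<open>Gelfand_surj\<close> provides an element of
  \<open>T\<close> with these values.\<close>

lemma ex1_transfer:
  assumes g: "g \<in> S"
  shows "\<exists>!h. h \<in> T \<and> (\<forall>p\<in>topspace K. b p h = a p g)"
proof (rule ex_ex1I)
  obtain b' where b': "homeomorphic_maps K (character_space B.alg) b b'"
    using hom_b homeomorphic_map_maps by blast
  have "continuous_map (character_space B.alg) (character_space A.alg) (a \<circ> b')"
    using b' homeomorphic_imp_continuous_map[OF hom_a]
    by (auto simp: homeomorphic_maps_def intro: continuous_map_compose)
  then have "continuous_map (character_space B.alg) euclidean ((\<lambda>\<xi>. \<xi> g) \<circ> (a \<circ> b'))"
    using continuous_map_character_space_apply by (rule continuous_map_compose)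
  moreover have "compact_space (character_space B.alg)"
    using compact hom_b homeomorphic_compact_space homeomorphic_map_imp_homeomorphic_space by blast
  ultimately obtain h where h: "h \<in> T" "\<forall>\<xi>\<in>characters B.alg. \<xi> h = ((\<lambda>\<xi>. \<xi> g) \<circ> (a \<circ> b')) \<xi>"
    using B.Gelfand_surj by blast
  have "b p h = a p g" if "p \<in> topspace K" for p
    using bspec[OF h(2) b_char[OF that]] b' that by (simp add: homeomorphic_maps_def)
  then show "\<exists>h. h \<in> T \<and> (\<forall>p\<in>topspace K. b p h = a p g)"
    using h(1) by blast
qed (use eq_if_chars_eq in auto)

text \<open>The algebra map dual to the homeomorphism \<open>a \<circ> b'\<close>, with b' the
  inverse of b. Since it is specified by its values under characters, each algebraic identity
  reduces through \<open>transfer_eqI\<close> to one between complex numbers.\<close>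

definition transfer :: "('a \<Rightarrow> complex) \<Rightarrow> 'b \<Rightarrow> complex" where
  "transfer = (\<lambda>g\<in>S. THE h. h \<in> T \<and> (\<forall>p\<in>topspace K. b p h = a p g))"

lemma transfer_in: "g \<in> S \<Longrightarrow> transfer g \<in> T"
  and transfer_char: "g \<in> S \<Longrightarrow> p \<in> topspace K \<Longrightarrow> b p (transfer g) = a p g"
  using theI'[OF ex1_transfer, of g] by (auto simp: transfer_def)

lemma transfer_eqI:
  "g \<in> S \<Longrightarrow> h \<in> T \<Longrightarrow> (\<And>p. p \<in> topspace K \<Longrightarrow> b p h = a p g) \<Longrightarrow> transfer g = h"
  by (rule eq_if_chars_eq) (auto simp: transfer_in transfer_char)

lemma transfer_hom: "transfer \<in> unital_star_hom A.alg B.alg"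
proof -
  have "transfer (\<lambda>x\<in>topspace X. f x + g x) = (\<lambda>y\<in>topspace Y. transfer f y + transfer g y)"
    if fg: "f \<in> S" "g \<in> S" for f g
    using fg A.add_in B.add_in transfer_in
    by (intro transfer_eqI) (simp_all add: A.char_add[OF a_char] B.char_add[OF b_char] transfer_char)
  moreover have "transfer (\<lambda>x\<in>topspace X. f x * g x) = (\<lambda>y\<in>topspace Y. transfer f y * transfer g y)"
    if fg: "f \<in> S" "g \<in> S" for f g
    using fg A.mult_in B.mult_in transfer_in
    by (intro transfer_eqI) (simp_all add: A.char_mult[OF a_char] B.char_mult[OF b_char] transfer_char)
  moreover have "transfer (\<lambda>x\<in>topspace X. c * f x) = (\<lambda>y\<in>topspace Y. c * transfer f y)"
    if f: "f \<in> S" for c f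
    using f A.smult_in B.smult_in transfer_in
    by (intro transfer_eqI) (simp_all add: A.char_smult[OF a_char] B.char_smult[OF b_char] transfer_char)
  moreover have "transfer (\<lambda>x\<in>topspace X. cnj (f x)) = (\<lambda>y\<in>topspace Y. cnj (transfer f y))"
    if f: "f \<in> S" for f
    using f A.star_in B.star_in transfer_in
    by (intro transfer_eqI) (simp_all add: A.char_star[OF a_char] B.char_star[OF b_char] transfer_char)
  moreover have "transfer (\<lambda>x\<in>topspace X. 1) = (\<lambda>y\<in>topspace Y. 1)"
    by (intro transfer_eqI A.const_in B.const_in)
      (simp only: A.char_const[OF a_char] B.char_const[OF b_char])
  moreover have "transfer \<in> extensional S"
    by (simp add: transfer_def)
  ultimately show ?thesis
    using transfer_in unfolding unital_star_hom_def
    by (intro CollectI conjI ring_hom_memI) auto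
qed

end

lemma isomorphism_transfer:
  fixes X Y :: "'a topology"
  assumes "Gelfand_dual_pair X S Y T K a b"
  shows "isomorphism CStarCom1 ((Cb X)\<lparr>carrier := S\<rparr>) ((Cb Y)\<lparr>carrier := T\<rparr>)
    (Gelfand_dual_pair.transfer S T K a b)"
proof -
  interpret Gelfand_dual_pair X S Y T K a b by fact
  interpret R: Gelfand_dual_pair Y T X S K b a
    by unfold_locales (rule compact hom_a hom_b)+
  have 1: "R.transfer (transfer g) = g" if "g \<in> S" for g
    using that transfer_in transfer_char by (intro R.transfer_eqI) auto
  have 2: "transfer (R.transfer g) = g" if "g \<in> T" for g
    using that R.transfer_in R.transfer_char by (intro transfer_eqI) auto
  have "compose S R.transfer transfer = (\<lambda>g\<in>S. g)" "compose T transfer R.transfer = (\<lambda>g\<in>T. g)"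
    using 1 2 by (auto simp: compose_def)
  then show ?thesis
    unfolding isomorphism_def using transfer_hom R.transfer_hom
    by (auto simp: CStarCom1_def)
qed

section \<open>Functions pulled back along a dense map into a compact space\<close>

locale dense_map_compact =
  fixes X :: "'a topology" and K :: "'b topology" and t :: "'a \<Rightarrow> 'b"
  assumes compact: "compact_space K" and Hausdorff: "Hausdorff_space K"
    and cont: "continuous_map X K t"
    and dense: "K closure_of (t ` topspace X) = topspace K"
begin

definition pullback :: "('b \<Rightarrow> complex) \<Rightarrow> 'a \<Rightarrow> complex" where
  "pullback k = (\<lambda>x\<in>topspace X. k (t x))"

definition pullbacks :: "('a \<Rightarrow> complex) set" where
  "pullbacks = pullback ` {k. continuous_map K euclidean k}"

lemma t_in: "x \<in> topspace X \<Longrightarrow> t x \<in> topspace K"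
  using continuous_map_image_subset_topspace[OF cont] by blast

lemma pullback_apply: "x \<in> topspace X \<Longrightarrow> pullback k x = k (t x)"
  by (simp add: pullback_def)

text \<open>The set where |k| is at most B is closed and contains the dense image. This makes
  \<open>pullback\<close> isometric; it yields both uniqueness of k on K and uniform convergence
  there.\<close>

lemma cmod_le_by_density:
  assumes k: "continuous_map K euclidean k"
    and B: "\<And>x. x \<in> topspace X \<Longrightarrow> cmod (k (t x)) \<le> B" and p: "p \<in> topspace K"
  shows "cmod (k p) \<le> B"
proof -
  have "closedin K {p \<in> topspace K. k p \<in> cball 0 B}"
    by (intro closedin_continuous_map_preimage[OF k]) auto
  then have "K closure_of (t ` topspace X) \<subseteq> {p \<in> topspace K. k p \<in> cball 0 B}"
    using B t_in by (intro closure_of_minimal) auto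
  then show ?thesis
    using p dense by auto
qed

lemma continuous_map_bounded:
  assumes k: "continuous_map K euclidean (k :: 'b \<Rightarrow> complex)"
  obtains B where "\<And>p. p \<in> topspace K \<Longrightarrow> cmod (k p) \<le> B"
proof -
  have "compactin euclidean (k ` topspace K)"
    using compact k image_compactin unfolding compact_space_def by blast
  then have "bounded (k ` topspace K)"
    by (simp add: compact_imp_bounded)
  then show thesis
    using that by (auto simp: bounded_iff)
qed

lemma closed_function_algebra_pullbacks: "closed_function_algebra X pullbacks"
proof
  show "pullbacks \<subseteq> carrier (Cb X)"
  proof
    fix g assume "g \<in> pullbacks"
    then obtain k where k: "continuous_map K euclidean k" "g = pullback k"
      by (auto simp: pullbacks_def)
    obtain B where "\<And>p. p \<in> topspace K \<Longrightarrow> cmod (k p) \<le> B"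
      using continuous_map_bounded[OF k(1)] by blast
    moreover have "continuous_map X euclidean (\<lambda>x. k (t x))"
      using continuous_map_compose[OF cont k(1)] by (simp add: o_def)
    ultimately show "g \<in> carrier (Cb X)"
      using t_in unfolding k(2) pullback_def
      by (intro in_CbI[of _ _ B]) (auto simp: continuous_map_restrict)
  qed
  show "(\<lambda>x\<in>topspace X. 1) \<in> pullbacks"
    unfolding pullbacks_def by (rule image_eqI[of _ _ "\<lambda>_. 1"]) (auto simp: pullback_def)
next
  fix f assume "f \<in> pullbacks"
  then obtain k where k: "continuous_map K euclidean k" "f = pullback k"
    by (auto simp: pullbacks_def)
  show "(\<lambda>x\<in>topspace X. c * f x) \<in> pullbacks" for c
    unfolding pullbacks_def using k
    by (intro image_eqI[of _ _ "\<lambda>p. c * k p"]) (auto simp: pullback_def intro!: continuous_map_complex_mult)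
  show "(\<lambda>x\<in>topspace X. cnj (f x)) \<in> pullbacks"
    unfolding pullbacks_def using k
    by (intro image_eqI[of _ _ "\<lambda>p. cnj (k p)"]) (auto simp: pullback_def intro!: continuous_map_cnj)
  fix g assume "g \<in> pullbacks"
  then obtain l where l: "continuous_map K euclidean l" "g = pullback l"
    by (auto simp: pullbacks_def)
  show "(\<lambda>x\<in>topspace X. f x + g x) \<in> pullbacks"
    unfolding pullbacks_def using k l
    by (intro image_eqI[of _ _ "\<lambda>p. k p + l p"]) (auto simp: pullback_def intro!: continuous_map_add)
  show "(\<lambda>x\<in>topspace X. f x * g x) \<in> pullbacks"
    unfolding pullbacks_def using k l
    by (intro image_eqI[of _ _ "\<lambda>p. k p * l p"]) (auto simp: pullback_def intro!: continuous_map_complex_mult)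
next
  fix g assume ext: "g \<in> extensional (topspace X)"
    and approx: "\<And>e. 0 < e \<Longrightarrow> \<exists>f\<in>pullbacks. \<forall>x\<in>topspace X. cmod (f x - g x) < e"
  have "\<exists>k. continuous_map K euclidean k \<and> (\<forall>x\<in>topspace X. cmod (k (t x) - g x) < inverse (Suc n))" for n
    using approx[of "inverse (Suc n)"] by (auto simp: pullbacks_def pullback_apply)
  then obtain k where k: "\<And>n::nat. continuous_map K euclidean (k n)"
    and kg: "\<And>n x. x \<in> topspace X \<Longrightarrow> cmod (k n (t x) - g x) < inverse (Suc n)"
    by metis
  have inv: "\<exists>N. \<forall>n\<ge>N. inverse (real (Suc n)) < e" if "0 < e" for e
  proof -
    obtain N where "inverse (real (Suc N)) < e"
      using reals_Archimedean[OF \<open>0 < e\<close>] by blast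
    moreover have "inverse (real (Suc n)) \<le> inverse (real (Suc N))" if "N \<le> n" for n
      using that by (simp add: field_simps)
    ultimately show ?thesis
      by (meson le_less_trans)
  qed
  have "\<exists>N. \<forall>m n p. N \<le> m \<and> N \<le> n \<and> p \<in> topspace K \<longrightarrow> dist (k m p) (k n p) < e" if "0 < e" for e
  proof -
    \<comment> \<open>Two errors below e/4 give e/2 on the image; density extends the bound to K
      with a weak inequality, still below e.\<close>
    obtain N where N: "\<And>n. N \<le> n \<Longrightarrow> inverse (real (Suc n)) < e / 4"
      using inv[of "e / 4"] \<open>0 < e\<close> by auto
    have "dist (k m p) (k n p) < e" if mn: "N \<le> m" "N \<le> n" and p: "p \<in> topspace K" for m n p
    proof -
      have "cmod (k m p - k n p) \<le> e / 2"
      proof (rule cmod_le_by_density[OF _ _ p])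
        show "continuous_map K euclidean (\<lambda>p. k m p - k n p)"
          using k by (intro continuous_map_diff)
        show "cmod (k m (t x) - k n (t x)) \<le> e / 2" if "x \<in> topspace X" for x
          using kg[OF that, of m] kg[OF that, of n] N[OF mn(1)] N[OF mn(2)]
            norm_triangle_ineq4[of "k m (t x) - g x" "k n (t x) - g x"] by simp
      qed
      then show ?thesis
        using \<open>0 < e\<close> by (simp add: dist_norm)
    qed
    then show ?thesis
      by blast
  qed
  then obtain l where l:
    "\<And>e. 0 < e \<Longrightarrow> \<exists>N. \<forall>n p. N \<le> n \<and> p \<in> topspace K \<longrightarrow> dist (k n p) (l p) < e"
    using uniformly_convergent_eq_cauchy[of "\<lambda>p. p \<in> topspace K" k] by blast
  \<comment> \<open>Continuity of the uniform limit comes from \<open>Cb_uniform_limit\<close> on K;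
    the restrictions serve only to make the functions extensional.\<close>
  have "restrict l (topspace K) \<in> carrier (Cb K)"
  proof (rule Cb_uniform_limit)
    fix e :: real assume "0 < e"
    then obtain N where N: "\<And>p. p \<in> topspace K \<Longrightarrow> dist (k N p) (l p) < e"
      using l by blast
    obtain B where "\<And>p. p \<in> topspace K \<Longrightarrow> cmod (k N p) \<le> B"
      using continuous_map_bounded[OF k[of N]] by blast
    then have "restrict (k N) (topspace K) \<in> carrier (Cb K)"
      using k by (intro in_CbI[of _ _ B]) (auto simp: continuous_map_restrict)
    then show "\<exists>f\<in>carrier (Cb K). \<forall>p\<in>topspace K. cmod (f p - restrict l (topspace K) p) < e"
      using N by (intro bexI[of _ "restrict (k N) (topspace K)"]) (auto simp: dist_norm)
  qed simp
  then have lc: "continuous_map K euclidean l"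
    by (simp add: in_Cb_iff continuous_map_restrict)
  have "l (t x) = g x" if x: "x \<in> topspace X" for x
  proof -
    have "cmod (l (t x) - g x) \<le> e" if e: "0 < e" for e
    proof -
      obtain N where N: "\<And>n. N \<le> n \<Longrightarrow> dist (k n (t x)) (l (t x)) < e / 2"
        using l[of "e / 2"] e t_in[OF x] by auto
      obtain M where M: "\<And>n. M \<le> n \<Longrightarrow> inverse (real (Suc n)) < e / 2"
        using inv[of "e / 2"] e by auto
      have "dist (k (max M N) (t x)) (l (t x)) < e / 2" "cmod (k (max M N) (t x) - g x) < e / 2"
        using N[of "max M N"] M[of "max M N"] kg[OF x, of "max M N"] by auto
      then show ?thesis
        using norm_triangle_ineq4[of "k (max M N) (t x) - g x" "k (max M N) (t x) - l (t x)"]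
        by (simp add: dist_norm)
    qed
    then have "cmod (l (t x) - g x) \<le> 0"
      by (rule field_le_epsilon) simp
    then show ?thesis
      by simp
  qed
  then have "g = pullback l"
    using ext by (intro extensionalityI[of _ "topspace X"]) (auto simp: pullback_def)
  then show "g \<in> pullbacks"
    using lc by (auto simp: pullbacks_def)
qed

sublocale P: closed_function_algebra X pullbacks
  by (rule closed_function_algebra_pullbacks)

text \<open>Evaluation at p, expressed on functions on X. The choice of k is harmless:
  \<open>\<eta>_pullback\<close> shows by density that all candidates agree on K.\<close>

definition \<eta> :: "'b \<Rightarrow> ('a \<Rightarrow> complex) \<Rightarrow> complex" where
  "\<eta> p = (\<lambda>g\<in>pullbacks. (SOME k. continuous_map K euclidean k \<and> pullback k = g) p)"

lemma pullback_in: "continuous_map K euclidean k \<Longrightarrow> pullback k \<in> pullbacks"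
  by (auto simp: pullbacks_def)

lemma \<eta>_pullback:
  assumes k: "continuous_map K euclidean k" and p: "p \<in> topspace K"
  shows "\<eta> p (pullback k) = k p"
proof -
  let ?k = "SOME k'. continuous_map K euclidean k' \<and> pullback k' = pullback k"
  have k': "continuous_map K euclidean ?k \<and> pullback ?k = pullback k"
    by (rule someI[of _ k]) (simp add: k)
  have "cmod (?k p - k p) \<le> 0"
  proof (rule cmod_le_by_density[OF _ _ p])
    show "continuous_map K euclidean (\<lambda>p. ?k p - k p)"
      using k k' by (intro continuous_map_diff) auto
    show "cmod (?k (t x) - k (t x)) \<le> 0" if "x \<in> topspace X" for x
      using pullback_apply[OF that, of ?k] pullback_apply[OF that, of k] k' by simp
  qed
  then show ?thesis
    using pullback_in[OF k] by (simp add: \<eta>_def)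
qed

lemma \<eta>_in: "p \<in> topspace K \<Longrightarrow> \<eta> p \<in> characters P.alg"
proof -
  assume p: "p \<in> topspace K"
  have "\<eta> p (\<lambda>x\<in>topspace X. f x + g x) = \<eta> p f + \<eta> p g \<and>
      \<eta> p (\<lambda>x\<in>topspace X. f x * g x) = \<eta> p f * \<eta> p g"
    if fg: "f \<in> pullbacks" "g \<in> pullbacks" for f g
  proof -
    obtain k l where k: "continuous_map K euclidean k" "f = pullback k"
      and l: "continuous_map K euclidean l" "g = pullback l"
      using fg by (auto simp: pullbacks_def)
    have "(\<lambda>x\<in>topspace X. f x + g x) = pullback (\<lambda>p. k p + l p)"
      "(\<lambda>x\<in>topspace X. f x * g x) = pullback (\<lambda>p. k p * l p)"
      by (auto simp: pullback_def k l)
    then show ?thesis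
      using k l p by (simp add: \<eta>_pullback continuous_map_add continuous_map_complex_mult)
  qed
  moreover have "\<eta> p (\<lambda>x\<in>topspace X. c * f x) = c * \<eta> p f" if f: "f \<in> pullbacks" for c f
  proof -
    obtain k where k: "continuous_map K euclidean k" "f = pullback k"
      using f by (auto simp: pullbacks_def)
    have "(\<lambda>x\<in>topspace X. c * f x) = pullback (\<lambda>p. c * k p)"
      by (auto simp: pullback_def k)
    then show ?thesis
      using k p by (simp add: \<eta>_pullback continuous_map_complex_mult)
  qed
  moreover have "\<eta> p (pullback (\<lambda>_. 1)) \<noteq> 0"
    using p by (simp add: \<eta>_pullback)
  moreover have "pullback (\<lambda>_. 1) \<in> pullbacks"
    by (simp add: pullback_in)
  moreover have "\<eta> p \<in> extensional pullbacks"
    by (simp add: \<eta>_def)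
  ultimately show ?thesis
    by (auto simp: characters_def)
qed

lemma \<eta>_t:
  assumes "x \<in> topspace X"
  shows "\<eta> (t x) = P.ev x"
proof (rule extensionalityI[of _ pullbacks])
  fix g assume g: "g \<in> pullbacks"
  then obtain k where "continuous_map K euclidean k" "g = pullback k"
    by (auto simp: pullbacks_def)
  then show "\<eta> (t x) g = P.ev x g"
    using g assms t_in by (simp add: \<eta>_pullback pullback_apply)
qed (auto simp: \<eta>_def P.ev_def)

lemma homeomorphic_map_\<eta>: "homeomorphic_map K (character_space P.alg) \<eta>"
proof (rule continuous_imp_homeomorphic_map[OF _ compact Hausdorff_character_space])
  show c: "continuous_map K (character_space P.alg) \<eta>"
  proof (rule continuous_map_into_character_space)
    fix f assume "f \<in> carrier P.alg"
    then obtain k where k: "continuous_map K euclidean k" "f = pullback k"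
      by (auto simp: pullbacks_def)
    show "continuous_map K euclidean (\<lambda>p. \<eta> p f)"
      by (rule continuous_map_eq[OF k(1)]) (simp add: k \<eta>_pullback)
  qed (rule \<eta>_in)
  show "\<eta> ` topspace K = topspace (character_space P.alg)"
  proof
    have "compactin (character_space P.alg) (\<eta> ` topspace K)"
      using compact c image_compactin unfolding compact_space_def by blast
    then have "closedin (character_space P.alg) (\<eta> ` topspace K)"
      by (rule compactin_imp_closedin[OF Hausdorff_character_space])
    moreover have "P.ev ` topspace X \<subseteq> \<eta> ` topspace K"
      using \<eta>_t t_in by (metis image_eqI image_subsetI)
    ultimately have "character_space P.alg closure_of (P.ev ` topspace X) \<subseteq> \<eta> ` topspace K"
      by (intro closure_of_minimal)
    then show "topspace (character_space P.alg) \<subseteq> \<eta> ` topspace K"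
      by (simp add: P.ev_dense)
  qed (use \<eta>_in in auto)
  have cr: "completely_regular_space K"
    using compact Hausdorff
    by (simp add: normal_imp_completely_regular_space compact_Hausdorff_or_regular_imp_normal_space)
  show "inj_on \<eta> (topspace K)"
  proof (rule inj_onI, rule ccontr)
    fix p q assume pq: "p \<in> topspace K" "q \<in> topspace K" "\<eta> p = \<eta> q" "p \<noteq> q"
    then have "closedin K {q}"
      using Hausdorff by (simp add: closedin_Hausdorff_singleton)
    then obtain f :: "'b \<Rightarrow> real" where f: "continuous_map K (top_of_set {0..1}) f" "f p = 0" "f q = 1"
      using cr pq unfolding completely_regular_space_def by (metis Diff_iff image_subset_iff insertI1 singletonD)
    then have "continuous_map K euclidean (\<lambda>p. complex_of_real (f p))"
      by (intro continuous_map_of_real) (simp add: continuous_map_in_subtopology)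
    then show False
      using \<eta>_pullback[of "\<lambda>p. complex_of_real (f p)"] pq f by (metis of_real_0 of_real_1 zero_neq_one)
  qed
qed

end

section \<open>Functors of function algebras\<close>

lemma subcategory_Tych:
  assumes "subcategory C Tych"
  shows "X \<in> Obj C \<Longrightarrow> Hausdorff_space X"
    and "X \<in> Obj C \<Longrightarrow> Ident C X = (\<lambda>x\<in>topspace X. x)"
    and "X \<in> Obj C \<Longrightarrow> Y \<in> Obj C \<Longrightarrow> f \<in> Hom C X Y \<Longrightarrow> continuous_map X Y f"
    and "X \<in> Obj C \<Longrightarrow> Y \<in> Obj C \<Longrightarrow> Z \<in> Obj C \<Longrightarrow> f \<in> Hom C X Y \<Longrightarrow> g \<in> Hom C Y Z \<Longrightarrow>
      Comp C X Y Z g f = compose (topspace X) g f"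
proof -
  show "X \<in> Obj C \<Longrightarrow> Hausdorff_space X"
    and "X \<in> Obj C \<Longrightarrow> Ident C X = (\<lambda>x\<in>topspace X. x)"
    using assms by (auto simp: subcategory_def Tych_def top_category_def)
  show "continuous_map X Y f" if "X \<in> Obj C" "Y \<in> Obj C" "f \<in> Hom C X Y"
  proof -
    have "f \<in> Hom Tych X Y"
      using assms that unfolding subcategory_def by blast
    then show ?thesis
      by (simp add: Tych_def top_category_def)
  qed
  show "Comp C X Y Z g f = compose (topspace X) g f"
    if "X \<in> Obj C" "Y \<in> Obj C" "Z \<in> Obj C" "f \<in> Hom C X Y" "g \<in> Hom C Y Z"
  proof -
    have "Comp C X Y Z g f = Comp Tych X Y Z g f"
      using assms that unfolding subcategory_def by blast
    then show ?thesis
      by (simp add: Tych_def top_category_def)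
  qed
qed

text \<open>The action on morphisms is forced to be precomposition, which respects all pointwise
  operations. For closed algebras \<open>S X\<close>, only their stability under precomposition
  remains to be checked.\<close>

lemma function_algebra_functorI:
  assumes sub: "subcategory C Tych"
    and alg: "\<And>X. X \<in> Obj C \<Longrightarrow> closed_function_algebra X (S X)"
    and comp: "\<And>X Y f g. X \<in> Obj C \<Longrightarrow> Y \<in> Obj C \<Longrightarrow> f \<in> Hom C X Y \<Longrightarrow> g \<in> S Y \<Longrightarrow>
      compose (topspace X) g f \<in> S X"
  shows "function_algebra_functor C
    \<lparr>Fobj = (\<lambda>X. (Cb X)\<lparr>carrier := S X\<rparr>), Fmor = (\<lambda>X Y f. \<lambda>g\<in>S Y. compose (topspace X) g f)\<rparr>"
proof -
  let ?pull = "\<lambda>X Y f. \<lambda>g\<in>S Y. compose (topspace X) g f"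
  have maps: "f x \<in> topspace Y"
    if "X \<in> Obj C" "Y \<in> Obj C" "f \<in> Hom C X Y" "x \<in> topspace X" for X Y f x
    using continuous_map_image_subset_topspace[OF subcategory_Tych(3)[OF sub that(1-3)]] that(4)
    by blast
  have hom: "?pull X Y f \<in> unital_star_hom ((Cb Y)\<lparr>carrier := S Y\<rparr>) ((Cb X)\<lparr>carrier := S X\<rparr>)"
    if XY: "X \<in> Obj C" "Y \<in> Obj C" "f \<in> Hom C X Y" for X Y f
  proof -
    interpret SX: closed_function_algebra X "S X" by (rule alg[OF XY(1)])
    interpret SY: closed_function_algebra Y "S Y" by (rule alg[OF XY(2)])
    show ?thesis
      unfolding unital_star_hom_def
      using comp[OF XY] maps[OF XY] SY.add_in SY.mult_in SY.smult_in SY.star_in SY.one_in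
      by (intro CollectI conjI ring_hom_memI) (auto simp: compose_def fun_eq_iff)
  qed
  have "?pull X X (Ident C X) = (\<lambda>g\<in>S X. g)" if X: "X \<in> Obj C" for X
  proof -
    interpret SX: closed_function_algebra X "S X" by (rule alg[OF X])
    have "compose (topspace X) g (\<lambda>x\<in>topspace X. x) = g" if "g \<in> S X" for g
      using SX.ext[OF that] by (auto simp: compose_def fun_eq_iff extensional_def)
    then show ?thesis
      by (simp add: subcategory_Tych(2)[OF sub X] cong: restrict_cong)
  qed
  moreover have "?pull X Z (Comp C X Y Z g f) = compose (S Z) (?pull X Y f) (?pull Y Z g)"
    if XYZ: "X \<in> Obj C" "Y \<in> Obj C" "Z \<in> Obj C" "f \<in> Hom C X Y" "g \<in> Hom C Y Z" for X Y Z f g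
    using comp[OF XYZ(2,3,5)] maps[OF XYZ(1,2,4)]
    by (auto simp: subcategory_Tych(4)[OF sub XYZ] compose_def fun_eq_iff)
  ultimately have "contravariant_functor C CStarCom1
    \<lparr>Fobj = (\<lambda>X. (Cb X)\<lparr>carrier := S X\<rparr>), Fmor = (\<lambda>X Y f. \<lambda>g\<in>S Y. compose (topspace X) g f)\<rparr>"
    unfolding contravariant_functor_def
    using hom closed_function_algebra.comm_unital_cstar_algebra_alg[OF alg]
    by (simp add: CStarCom1_def)
  then show ?thesis
    unfolding function_algebra_functor_def using alg
    by (simp add: unital_cstar_subalgebra_Cb_iff)
qed

lemma function_algebra_functorD:
  assumes "function_algebra_functor C G"
  shows "X \<in> Obj C \<Longrightarrow> closed_function_algebra X (carrier (Fobj G X))"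
    and "X \<in> Obj C \<Longrightarrow> Fobj G X = (Cb X)\<lparr>carrier := carrier (Fobj G X)\<rparr>"
    and "X \<in> Obj C \<Longrightarrow> Y \<in> Obj C \<Longrightarrow> f \<in> Hom C X Y \<Longrightarrow>
      Fmor G X Y f = (\<lambda>g\<in>carrier (Fobj G Y). compose (topspace X) g f)"
    and "X \<in> Obj C \<Longrightarrow> Y \<in> Obj C \<Longrightarrow> f \<in> Hom C X Y \<Longrightarrow> g \<in> carrier (Fobj G Y) \<Longrightarrow>
      compose (topspace X) g f \<in> carrier (Fobj G X)"
proof -
  show "X \<in> Obj C \<Longrightarrow> closed_function_algebra X (carrier (Fobj G X))"
    and "X \<in> Obj C \<Longrightarrow> Fobj G X = (Cb X)\<lparr>carrier := carrier (Fobj G X)\<rparr>"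
    using assms unital_cstar_subalgebra_Cb_iff unfolding function_algebra_functor_def by blast+
  show mor: "Fmor G X Y f = (\<lambda>g\<in>carrier (Fobj G Y). compose (topspace X) g f)"
    if "X \<in> Obj C" "Y \<in> Obj C" "f \<in> Hom C X Y"
    using assms that unfolding function_algebra_functor_def by blast
  assume XY: "X \<in> Obj C" "Y \<in> Obj C" "f \<in> Hom C X Y" and g: "g \<in> carrier (Fobj G Y)"
  have "Fmor G X Y f \<in> Hom CStarCom1 (Fobj G Y) (Fobj G X)"
    using assms XY unfolding function_algebra_functor_def contravariant_functor_def by blast
  then have "Fmor G X Y f \<in> ring_hom (Fobj G Y) (Fobj G X)"
    by (simp add: CStarCom1_def unital_star_hom_def)
  then have "Fmor G X Y f g \<in> carrier (Fobj G X)"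
    using g by (rule ring_hom_closed)
  then show "compose (topspace X) g f \<in> carrier (Fobj G X)"
    using g by (simp add: mor[OF XY])
qed

text \<open>With \<open>Phi\<close> unfolded, naturality becomes an equation between values of
  characters at functions, the form in which it is both proved and used.\<close>

lemma natural_isomorphism_induced_iff:
  assumes G: "function_algebra_functor C G"
  shows "top_natural_isomorphism C F (induced_functor G) \<eta> \<longleftrightarrow>
    (\<forall>X\<in>Obj C. homeomorphic_map (Fobj F X) (character_space (Fobj G X)) (\<eta> X)) \<and>
    (\<forall>X\<in>Obj C. \<forall>Y\<in>Obj C. \<forall>f\<in>Hom C X Y. \<forall>p\<in>topspace (Fobj F X).
       \<eta> Y (Fmor F X Y f p) =
       (\<lambda>g\<in>carrier (Fobj G Y). \<eta> X p (compose (topspace X) g f)))"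
proof -
  have "Fmor (induced_functor G) X Y f (\<eta> X p) =
      (\<lambda>g\<in>carrier (Fobj G Y). \<eta> X p (compose (topspace X) g f))"
    if "homeomorphic_map (Fobj F X) (character_space (Fobj G X)) (\<eta> X)"
      and XY: "X \<in> Obj C" "Y \<in> Obj C" "f \<in> Hom C X Y" and p: "p \<in> topspace (Fobj F X)"
    for X Y f p
  proof -
    \<comment> \<open>The morphism part of \<open>Phi\<close> is restricted to characters, so its
      value is known only once \<open>\<eta> X p\<close> is one.\<close>
    have "\<eta> X p \<in> characters (Fobj G X)"
      using homeomorphic_imp_surjective_map[OF that(1)] p by auto
    then show ?thesis
      by (auto simp: induced_functor_def comp_contravariant_def Phi_def
          function_algebra_functorD(3)[OF G XY] compose_def fun_eq_iff)
  qed
  moreover have "Fobj (induced_functor G) X = character_space (Fobj G X)" for X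
    by (simp add: induced_functor_def comp_contravariant_def Phi_def)
  ultimately show ?thesis
    unfolding top_natural_isomorphism_def by (intro conj_cong ball_cong refl) simp_all
qed

lemma preweak_compactification_functorD:
  assumes "preweak_compactification_functor C F \<tau>"
  shows "X \<in> Obj C \<Longrightarrow> dense_map_compact X (Fobj F X) (\<tau> X)"
    and "X \<in> Obj C \<Longrightarrow> Y \<in> Obj C \<Longrightarrow> f \<in> Hom C X Y \<Longrightarrow>
      continuous_map (Fobj F X) (Fobj F Y) (Fmor F X Y f)"
    and "X \<in> Obj C \<Longrightarrow> Y \<in> Obj C \<Longrightarrow> f \<in> Hom C X Y \<Longrightarrow> x \<in> topspace X \<Longrightarrow>
      Fmor F X Y f (\<tau> X x) = \<tau> Y (f x)"
proof -
  have F: "covariant_functor C CompHaus F"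
    using assms by (simp add: preweak_compactification_functor_def)
  show "dense_map_compact X (Fobj F X) (\<tau> X)" if X: "X \<in> Obj C"
  proof
    have "Fobj F X \<in> Obj CompHaus"
      using F X by (simp add: covariant_functor_def)
    then show "compact_space (Fobj F X)" "Hausdorff_space (Fobj F X)"
      by (simp_all add: CompHaus_def top_category_def)
  qed (use assms X in \<open>auto simp: preweak_compactification_functor_def\<close>)
  show "continuous_map (Fobj F X) (Fobj F Y) (Fmor F X Y f)"
    if "X \<in> Obj C" "Y \<in> Obj C" "f \<in> Hom C X Y"
  proof -
    have "Fmor F X Y f \<in> Hom CompHaus (Fobj F X) (Fobj F Y)"
      using F that by (simp add: covariant_functor_def)
    then show ?thesis
      by (simp add: CompHaus_def top_category_def)
  qed
  show "X \<in> Obj C \<Longrightarrow> Y \<in> Obj C \<Longrightarrow> f \<in> Hom C X Y \<Longrightarrow> x \<in> topspace X \<Longrightarrow>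
      Fmor F X Y f (\<tau> X x) = \<tau> Y (f x)"
    using assms by (simp add: preweak_compactification_functor_def)
qed

section \<open>Existence, uniqueness and the separation criteria\<close>

lemma ex_represents_along:
  fixes C :: "('a topology, 'a \<Rightarrow> 'a) category"
    and F :: "('a topology, 'a \<Rightarrow> 'a, 'b topology, 'b \<Rightarrow> 'b) fctr"
  assumes C: "subcategory C Tych" and F: "preweak_compactification_functor C F \<tau>"
  shows "\<exists>G. represents_along C G F \<tau>"
proof -
  note D = preweak_compactification_functorD(1)[OF F]
  define pull where "pull X = dense_map_compact.pullback X (\<tau> X)" for X
  define S where "S X = dense_map_compact.pullbacks X (Fobj F X) (\<tau> X)" for X
  define \<eta> where "\<eta> X = dense_map_compact.\<eta> X (Fobj F X) (\<tau> X)" for X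
  define G :: "'a function_algebra_fctr" where "G = \<lparr>Fobj = (\<lambda>X. (Cb X)\<lparr>carrier := S X\<rparr>),
    Fmor = (\<lambda>X Y f. \<lambda>g\<in>S Y. compose (topspace X) g f)\<rparr>"
  have Sobj: "S X = pull X ` {k. continuous_map (Fobj F X) euclidean k}" if "X \<in> Obj C" for X
    unfolding S_def pull_def by (rule dense_map_compact.pullbacks_def[OF D[OF that]])
  have pull_apply: "pull X k x = k (\<tau> X x)" if "X \<in> Obj C" "x \<in> topspace X" for X k x
    unfolding pull_def by (rule dense_map_compact.pullback_apply[OF D[OF that(1)] that(2)])
  \<comment> \<open>Naturality of \<open>\<tau>\<close> rewrites k after \<open>\<tau> Y\<close>
    after f as k after F(f) after \<open>\<tau> X\<close>. Both the stability of the algebras and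
    the naturality of \<open>\<eta>\<close> rest on this.\<close>
  have pull_comp: "compose (topspace X) (pull Y k) f = pull X (k \<circ> Fmor F X Y f)"
    if XY: "X \<in> Obj C" "Y \<in> Obj C" "f \<in> Hom C X Y" for X Y f k
  proof
    fix x
    have "f x \<in> topspace Y" if "x \<in> topspace X"
      using continuous_map_image_subset_topspace[OF subcategory_Tych(3)[OF C XY]] that by blast
    moreover have "pull X l x = undefined" if "x \<notin> topspace X" for l
      unfolding pull_def dense_map_compact.pullback_def[OF D[OF XY(1)]] using that by simp
    ultimately show "compose (topspace X) (pull Y k) f x = pull X (k \<circ> Fmor F X Y f) x"
      using XY preweak_compactification_functorD(3)[OF F XY, of x]
      by (cases "x \<in> topspace X") (auto simp: compose_def pull_apply)
  qed
  have comp: "compose (topspace X) g f \<in> S X"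
    if XY: "X \<in> Obj C" "Y \<in> Obj C" "f \<in> Hom C X Y" and g: "g \<in> S Y" for X Y f g
  proof -
    obtain k where k: "continuous_map (Fobj F Y) euclidean k" "g = pull Y k"
      using g Sobj[OF XY(2)] by auto
    have "continuous_map (Fobj F X) euclidean (k \<circ> Fmor F X Y f)"
      using preweak_compactification_functorD(2)[OF F XY] k(1) by (rule continuous_map_compose)
    then show ?thesis
      unfolding k(2) pull_comp[OF XY] Sobj[OF XY(1)] by blast
  qed
  have G: "function_algebra_functor C G"
    unfolding G_def
    by (rule function_algebra_functorI[OF C _ comp])
      (simp add: S_def dense_map_compact.closed_function_algebra_pullbacks[OF D])
  have \<eta>_pull: "\<eta> X p (pull X k) = k p"
    if "X \<in> Obj C" "continuous_map (Fobj F X) euclidean k" "p \<in> topspace (Fobj F X)" for X k p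
    unfolding \<eta>_def pull_def by (rule dense_map_compact.\<eta>_pullback[OF D[OF that(1)] that(2,3)])
  have nat: "\<eta> Y (Fmor F X Y f p) = (\<lambda>g\<in>carrier (Fobj G Y). \<eta> X p (compose (topspace X) g f))"
    if XY: "X \<in> Obj C" "Y \<in> Obj C" "f \<in> Hom C X Y" and p: "p \<in> topspace (Fobj F X)" for X Y f p
  proof (rule extensionalityI[of _ "S Y"])
    note Ff = preweak_compactification_functorD(2)[OF F XY]
    fix g assume g: "g \<in> S Y"
    then obtain k where k: "continuous_map (Fobj F Y) euclidean k" "g = pull Y k"
      using Sobj[OF XY(2)] by auto
    have "Fmor F X Y f p \<in> topspace (Fobj F Y)"
      using continuous_map_image_subset_topspace[OF Ff] p by blast
    then have "\<eta> Y (Fmor F X Y f p) g = (k \<circ> Fmor F X Y f) p"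
      unfolding k(2) by (simp add: \<eta>_pull[OF XY(2) k(1)])
    also have "\<dots> = \<eta> X p (compose (topspace X) g f)"
      unfolding k(2) pull_comp[OF XY]
      by (rule \<eta>_pull[OF XY(1) continuous_map_compose[OF Ff k(1)] p, symmetric])
    finally show "\<eta> Y (Fmor F X Y f p) g =
        (\<lambda>g\<in>carrier (Fobj G Y). \<eta> X p (compose (topspace X) g f)) g"
      using g by (simp add: G_def)
  qed (simp_all add: G_def \<eta>_def S_def dense_map_compact.\<eta>_def[OF D[OF XY(2)]])
  have hom: "homeomorphic_map (Fobj F X) (character_space (Fobj G X)) (\<eta> X)" if "X \<in> Obj C" for X
    using dense_map_compact.homeomorphic_map_\<eta>[OF D[OF that]] by (simp add: G_def \<eta>_def S_def)
  have "top_natural_isomorphism C F (induced_functor G) \<eta>"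
    unfolding natural_isomorphism_induced_iff[OF G] using hom nat by blast
  moreover have "\<eta> X (\<tau> X x) = evaluation G X x" if "X \<in> Obj C" "x \<in> topspace X" for X x
  proof -
    interpret X: dense_map_compact X "Fobj F X" "\<tau> X" by (rule D[OF that(1)])
    show ?thesis
      using X.\<eta>_t[OF that(2)] by (simp add: X.P.ev_def evaluation_def G_def S_def \<eta>_def)
  qed
  ultimately show ?thesis
    using G unfolding represents_along_def by blast
qed

lemma represents_imp_contra_naturally_isomorphic:
  assumes F: "preweak_compactification_functor C F \<tau>"
    and "represents C G F" "represents C H F"
  shows "contra_naturally_isomorphic C CStarCom1 G H"
proof -
  obtain \<eta> \<theta> where G: "function_algebra_functor C G"
    and H: "function_algebra_functor C H"
    and \<eta>: "top_natural_isomorphism C F (induced_functor G) \<eta>"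
    and \<theta>: "top_natural_isomorphism C F (induced_functor H) \<theta>"
    using assms(2,3) unfolding represents_def by blast
  note \<eta> = \<eta>[unfolded natural_isomorphism_induced_iff[OF G]]
  note \<theta> = \<theta>[unfolded natural_isomorphism_induced_iff[OF H]]
  let ?S = "\<lambda>X. carrier (Fobj G X)" and ?T = "\<lambda>X. carrier (Fobj H X)"
  define \<alpha> where "\<alpha> X = Gelfand_dual_pair.transfer (?S X) (?T X) (Fobj F X) (\<eta> X) (\<theta> X)" for X
  have pair: "Gelfand_dual_pair X (?S X) X (?T X) (Fobj F X) (\<eta> X) (\<theta> X)" if X: "X \<in> Obj C" for X
  proof -
    interpret S: closed_function_algebra X "?S X"
      by (rule function_algebra_functorD(1)[OF G X])
    interpret T: closed_function_algebra X "?T X"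
      by (rule function_algebra_functorD(1)[OF H X])
    show ?thesis
    proof
      show "compact_space (Fobj F X)"
        using preweak_compactification_functorD(1)[OF F X] by (rule dense_map_compact.compact)
      show "homeomorphic_map (Fobj F X) (character_space S.alg) (\<eta> X)"
        using \<eta> X function_algebra_functorD(2)[OF G X] by simp
      show "homeomorphic_map (Fobj F X) (character_space T.alg) (\<theta> X)"
        using \<theta> X function_algebra_functorD(2)[OF H X] by simp
    qed
  qed
  have iso: "isomorphism CStarCom1 (Fobj G X) (Fobj H X) (\<alpha> X)" if X: "X \<in> Obj C" for X
    using isomorphism_transfer[OF pair[OF X]] function_algebra_functorD(2)[OF G X]
      function_algebra_functorD(2)[OF H X] by (simp add: \<alpha>_def)
  have "compose (?S Y) (\<alpha> X) (Fmor G X Y f) = compose (?S Y) (Fmor H X Y f) (\<alpha> Y)"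
    if XY: "X \<in> Obj C" "Y \<in> Obj C" "f \<in> Hom C X Y" for X Y f
  proof -
    interpret X: Gelfand_dual_pair X "?S X" X "?T X" "Fobj F X" "\<eta> X" "\<theta> X"
      by (rule pair[OF XY(1)])
    interpret Y: Gelfand_dual_pair Y "?S Y" Y "?T Y" "Fobj F Y" "\<eta> Y" "\<theta> Y"
      by (rule pair[OF XY(2)])
    \<comment> \<open>Tested on the characters \<open>\<theta> X p\<close>: naturality of
      \<open>\<theta>\<close> moves the point to F(f)(p), the transfer property at Y replaces
      \<open>\<theta>\<close> by \<open>\<eta>\<close>, and naturality of \<open>\<eta>\<close>
      moves back.\<close>
    have "\<alpha> X (compose (topspace X) g f) = compose (topspace X) (\<alpha> Y g) f" if g: "g \<in> ?S Y" for g
      unfolding \<alpha>_def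
    proof (rule X.transfer_eqI)
      have \<alpha>g: "Y.transfer g \<in> ?T Y"
        by (rule Y.transfer_in[OF g])
      show "compose (topspace X) g f \<in> ?S X"
        by (rule function_algebra_functorD(4)[OF G XY g])
      show "compose (topspace X) (Y.transfer g) f \<in> ?T X"
        by (rule function_algebra_functorD(4)[OF H XY \<alpha>g])
      fix p assume p: "p \<in> topspace (Fobj F X)"
      have Fp: "Fmor F X Y f p \<in> topspace (Fobj F Y)"
        using continuous_map_image_subset_topspace[OF preweak_compactification_functorD(2)[OF F XY]] p
        by blast
      have "\<theta> X p (compose (topspace X) (Y.transfer g) f) = \<theta> Y (Fmor F X Y f p) (Y.transfer g)"
        using \<theta> XY p \<alpha>g by simp
      also have "\<dots> = \<eta> Y (Fmor F X Y f p) g"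
        by (rule Y.transfer_char[OF g Fp])
      also have "\<dots> = \<eta> X p (compose (topspace X) g f)"
        using \<eta> XY p g by simp
      finally show "\<theta> X p (compose (topspace X) (Y.transfer g) f) =
          \<eta> X p (compose (topspace X) g f)" .
    qed
    moreover have "\<alpha> Y g \<in> ?T Y" if "g \<in> ?S Y" for g
      using Y.transfer_in[OF that] by (simp add: \<alpha>_def)
    ultimately show ?thesis
      by (auto simp: compose_def fun_eq_iff function_algebra_functorD(3)[OF G XY]
          function_algebra_functorD(3)[OF H XY])
  qed
  then show ?thesis
    unfolding contra_naturally_isomorphic_def using iso
    by (intro exI[of _ \<alpha>]) (simp add: CStarCom1_def)
qed

text \<open>Along \<open>represents_along\<close>, \<open>\<tau> X\<close> and the evaluation map
  differ only by a homeomorphism, so injectivity and being an embedding pass between them.\<close>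

lemma represents_along_embedding_iff:
  assumes "represents_along C G F \<tau>" and X: "X \<in> Obj C"
    and \<tau>: "\<And>x. x \<in> topspace X \<Longrightarrow> \<tau> X x \<in> topspace (Fobj F X)"
  shows "inj_on (\<tau> X) (topspace X) \<longleftrightarrow> separates_points X (carrier (Fobj G X))"
    and "t1_space X \<Longrightarrow> embedding_map X (Fobj F X) (\<tau> X) \<longleftrightarrow>
      separates_points_closed_sets X (carrier (Fobj G X))"
proof -
  obtain \<eta> where G: "function_algebra_functor C G"
    and \<eta>: "top_natural_isomorphism C F (induced_functor G) \<eta>"
    and ev: "\<And>x. x \<in> topspace X \<Longrightarrow> \<eta> X (\<tau> X x) = evaluation G X x"
    using assms(1) X unfolding represents_along_def by blast
  interpret closed_function_algebra X "carrier (Fobj G X)"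
    by (rule function_algebra_functorD(1)[OF G X])
  have hom: "homeomorphic_map (Fobj F X) (character_space alg) (\<eta> X)"
    using \<eta> X function_algebra_functorD(2)[OF G X]
    unfolding natural_isomorphism_induced_iff[OF G] by simp
  have ev: "\<eta> X (\<tau> X x) = local.ev x" if "x \<in> topspace X" for x
    using ev[OF that] by (simp add: evaluation_def local.ev_def)
  obtain \<eta>' where \<eta>': "homeomorphic_map (character_space alg) (Fobj F X) \<eta>'"
    "\<And>p. p \<in> topspace (Fobj F X) \<Longrightarrow> \<eta>' (\<eta> X p) = p"
    using hom unfolding homeomorphic_map_maps homeomorphic_maps_def by blast
  have ev': "\<eta>' (local.ev x) = \<tau> X x" if "x \<in> topspace X" for x
    using ev[OF that] \<eta>'(2)[OF \<tau>[OF that]] by simp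
  have "inj_on (\<tau> X) (topspace X) \<longleftrightarrow> inj_on local.ev (topspace X)"
    using ev ev' unfolding inj_on_def by metis
  then show "inj_on (\<tau> X) (topspace X) \<longleftrightarrow> separates_points X (carrier (Fobj G X))"
    by (simp only: inj_on_ev_iff)
  assume t1: "t1_space X"
  have "embedding_map X (Fobj F X) (\<tau> X) \<longleftrightarrow> embedding_map X (character_space alg) local.ev"
  proof
    assume "embedding_map X (Fobj F X) (\<tau> X)"
    moreover have "embedding_map (Fobj F X) (character_space alg) (\<eta> X)"
      using hom surjective_embedding_map by blast
    ultimately have "embedding_map X (character_space alg) (\<eta> X \<circ> \<tau> X)"
      by (rule embedding_map_compose)
    then show "embedding_map X (character_space alg) local.ev"
      by (rule embedding_map_eq) (simp add: ev)
  next
    assume "embedding_map X (character_space alg) local.ev"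
    moreover have "embedding_map (character_space alg) (Fobj F X) \<eta>'"
      using \<eta>'(1) surjective_embedding_map by blast
    ultimately have "embedding_map X (Fobj F X) (\<eta>' \<circ> local.ev)"
      by (rule embedding_map_compose)
    then show "embedding_map X (Fobj F X) (\<tau> X)"
      by (rule embedding_map_eq) (simp add: ev')
  qed
  then show "embedding_map X (Fobj F X) (\<tau> X) \<longleftrightarrow>
      separates_points_closed_sets X (carrier (Fobj G X))"
    by (simp only: embedding_map_ev_iff[OF t1])
qed

theorem proposition4p2:
  fixes C :: "('a topology, 'a \<Rightarrow> 'a) category"
    and F :: "('a topology, 'a \<Rightarrow> 'a, 'b topology, 'b \<Rightarrow> 'b) fctr"
    and \<tau> :: "'a topology \<Rightarrow> 'a \<Rightarrow> 'b"
  assumes "subcategory C Tych"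
    and "preweak_compactification_functor C F \<tau>"
  shows
    "(\<exists>G. represents C G F \<and> represents_along C G F \<tau>) \<and>
     (\<forall>G H. represents C G F \<and> represents C H F \<longrightarrow> contra_naturally_isomorphic C CStarCom1 G H) \<and>
     (\<forall>G. represents_along C G F \<tau> \<longrightarrow>
        (weak_compactification_functor C F \<tau> \<longleftrightarrow>
           (\<forall>X\<in>Obj C. separates_points X (carrier (Fobj G X)))) \<and>
        ((\<forall>X\<in>Obj C. locally_compact_space X) \<longrightarrow>
           (compactification_functor C F \<tau> \<longleftrightarrow>
              (\<forall>X\<in>Obj C. separates_points_closed_sets X (carrier (Fobj G X))))))"
proof (intro conjI allI impI)
  obtain G where "represents_along C G F \<tau>"
    using ex_represents_along[OF assms] by blast
  then show "\<exists>G. represents C G F \<and> represents_along C G F \<tau>"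
    unfolding represents_def represents_along_def by blast
next
  fix G H assume "represents C G F \<and> represents C H F"
  then show "contra_naturally_isomorphic C CStarCom1 G H"
    using represents_imp_contra_naturally_isomorphic[OF assms(2)] by blast
next
  fix G assume G: "represents_along C G F \<tau>"
  have \<tau>: "\<tau> X x \<in> topspace (Fobj F X)" if "X \<in> Obj C" "x \<in> topspace X" for X x
    using preweak_compactification_functorD(1)[OF assms(2) that(1)] that(2)
    by (rule dense_map_compact.t_in)
  note iff = represents_along_embedding_iff[OF G _ \<tau>]
  show "weak_compactification_functor C F \<tau> \<longleftrightarrow>
      (\<forall>X\<in>Obj C. separates_points X (carrier (Fobj G X)))"
    unfolding weak_compactification_functor_def using assms(2) iff(1) by blast
  \<comment> \<open>Tychonoff spaces here are Hausdorff, hence their points are closed, as the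
    embedding criterion requires.\<close>
  have "t1_space X" if "X \<in> Obj C" for X
    using subcategory_Tych(1)[OF assms(1) that] by (rule Hausdorff_imp_t1_space)
  then show "compactification_functor C F \<tau> \<longleftrightarrow>
      (\<forall>X\<in>Obj C. separates_points_closed_sets X (carrier (Fobj G X)))"
    unfolding compactification_functor_def using assms(2) iff(2) by blast
qed

end
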